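(* There are uncountably many pairwise non-isomorphic topological groups that are totally disconnected, locally compact, compactly generated, simple (as abstract groups) and not discrete. *)

theory Defs
  imports "HOL-Analysis.Analysis" "HOL-Algebra.Generated_Groups" "HOL-Algebra.Coset"
begin

definition topological_group :: "('a, 'b) monoid_scheme \<Rightarrow> 'a topology \<Rightarrow> bool" where
  "topological_group G T \<longleftrightarrow>
     group G \<and> topspace T = carrier G \<and>
     continuous_map (prod_topology T T) T (\<lambda>(x, y). x \<otimes>\<^bsub>G\<^esub> y) \<and>
     continuous_map T T (\<lambda>x. inv\<^bsub>G\<^esub> x)"

definition topgroup_isomorphic ::
  "('a, 'b) monoid_scheme \<Rightarrow> 'a topology \<Rightarrow> ('c, 'd) monoid_scheme \<Rightarrow> 'c topology \<Rightarrow> bool" where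
  "topgroup_isomorphic G T H U \<longleftrightarrow> (\<exists>f. f \<in> iso G H \<and> homeomorphic_map T U f)"

definition abstractly_simple :: "('a, 'b) monoid_scheme \<Rightarrow> bool" where
  "abstractly_simple G \<longleftrightarrow> carrier G \<noteq> {\<one>\<^bsub>G\<^esub>} \<and>
     (\<forall>N. N \<lhd> G \<longrightarrow> N = {\<one>\<^bsub>G\<^esub>} \<or> N = carrier G)"

definition totally_disconnected_space :: "'a topology \<Rightarrow> bool" where
  "totally_disconnected_space T \<longleftrightarrow>
     (\<forall>x \<in> topspace T. connected_component_of_set T x = {x})"

definition compactly_generated_group :: "('a, 'b) monoid_scheme \<Rightarrow> 'a topology \<Rightarrow> bool" where
  "compactly_generated_group G T \<longleftrightarrow>
     (\<exists>K. compactin T K \<and> K \<subseteq> carrier G \<and> generate G K = carrier G)"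

end

theory Submission
  imports Defs
begin

unbundle no m_inv_syntax

text \<open>The groups are the type-preserving universal groups of Burger and Mozes acting on the tree in which
  every vertex meets one edge of each colour \<open>d :: nat\<close>: automorphisms whose local action at every
  vertex lies in a fixed permutation group \<open>F\<close> of the colours. Let \<open>F\<close> be infinite, finitely
  generated, transitive, with finite nontrivial point stabilisers that generate \<open>F\<close>. Finiteness of the
  stabilisers makes edge stabilisers compact and open, finite generation of \<open>F\<close> gives compact
  generation, and simplicity follows from Tits' independence argument.

  The permutation group \<open>F\<close> is the quotient of a vertex stabiliser by a compact open subgroup. A
  second countable locally compact group has only countably many compact open subgroups, hence only
  countably many finitely generated marked groups arise in this way from any one of the groups. It
  therefore suffices to exhibit uncountably many local actions \<open>F\<close> with different relators; no
  isomorphism invariant is needed.\<close>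

section \<open>The coloured tree\<close>

text \<open>The tree has infinite valency, so vertex stabilisers, being transitive on neighbours,
  are never compact. Finite point stabilisers of \<open>F\<close> take the place of local
  finiteness: once the image of a single edge at a vertex is known, only finitely many local actions
  remain there, so the fixator of an edge has finite orbits. Infinite valency in return yields
  non-discreteness: finitely many vertices leave some half-tree at \<open>origin\<close> untouched.
  What is counted is marked groups, a marking being recorded as the set of words in the generators
  that evaluate to the identity. An isomorphism of topological groups knows nothing of vertices, but
  it sends the fixator of the unit ball to a compact open subgroup \<open>L\<close> of the target,
  and lifts of the generators to elements normalising \<open>L\<close>. Which words in these fall
  into \<open>L\<close> depends only on finitely many values at finitely many vertices, hence on a
  parameter from a countable set.\<close>

typedef vert = "{w :: nat list. distinct_adj w}" morphisms word Vert
  by (rule exI[of _ "[]"]) simp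

definition origin :: vert where
  "origin = Vert []"

text \<open>A vertex is a reduced word in involutions, written backwards, and the neighbour across the edge
  of colour \<open>d\<close> is obtained by right multiplication with \<open>d\<close>. Every vertex thus meets exactly one
  edge of each colour.\<close>

definition nb :: "vert \<Rightarrow> nat \<Rightarrow> vert" where
  "nb v d = Vert (case word v of [] \<Rightarrow> [d] | c # w \<Rightarrow> if c = d then w else d # c # w)"

definition par :: "vert \<Rightarrow> bool" where
  "par v \<longleftrightarrow> even (length (word v))"

lemma distinct_adj_word: "distinct_adj (word v)"
  using word by auto

lemma word_origin [simp]: "word origin = []"
  by (simp add: origin_def Vert_inverse)

lemma word_nb:
  "word (nb v d) = (case word v of [] \<Rightarrow> [d] | c # w \<Rightarrow> if c = d then w else d # c # w)"
  unfolding nb_def using distinct_adj_word[of v]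
  by (subst Vert_inverse) (auto split: list.splits simp: distinct_adj_Cons)

lemma nb_nb [simp]: "nb (nb v d) d = v"
  using distinct_adj_word[of v]
  by (subst word_inject[symmetric]) (auto simp: word_nb distinct_adj_Cons split: list.splits)

lemma nb_eq_iff [simp]: "nb v c = nb v d \<longleftrightarrow> c = d"
proof
  assume "nb v c = nb v d"
  then have "word (nb v c) = word (nb v d)" by simp
  then show "c = d" by (auto simp: word_nb split: list.splits if_splits)
qed simp

lemma par_origin [simp]: "par origin"
  by (simp add: par_def)

lemma par_nb [simp]: "par (nb v d) \<longleftrightarrow> \<not> par v"
  by (auto simp: par_def word_nb split: list.splits)

lemma vert_induct [case_names origin nb]:
  assumes "P origin" and step: "\<And>v d. P v \<Longrightarrow> P (nb v d)"
  shows "P v"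
proof -
  have "P (Vert w)" if "distinct_adj w" for w
    using that
  proof (induction w)
    case Nil
    then show ?case using \<open>P origin\<close> by (simp add: origin_def)
  next
    case (Cons d w)
    then have w: "distinct_adj w" by (auto simp: distinct_adj_Cons)
    have "word (nb (Vert w) d) = d # w"
      using Cons.prems w by (auto simp: word_nb Vert_inverse distinct_adj_Cons split: list.splits)
    then have "Vert (d # w) = nb (Vert w) d" by (metis word_inverse)
    then show ?case using step Cons.IH[OF w] by simp
  qed
  from this[OF distinct_adj_word, of v] show ?thesis by (simp add: word_inverse)
qed

text \<open>The path from \<open>origin\<close> to \<open>u\<close> can be walked back, since each
  colour acts on vertices as an involution; so every vertex may serve as base point.\<close>

lemma vert_induct_from [case_names base nb]:
  assumes "P u" and step: "\<And>v d. P v \<Longrightarrow> P (nb v d)"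
  shows "P v"
proof -
  have "P u \<longrightarrow> P origin"
  proof (induction u rule: vert_induct)
    case (nb v d)
    then show ?case using step[of "nb v d" d] by auto
  qed simp
  then show ?thesis using assms by (induction v rule: vert_induct) auto
qed

text \<open>The reduced word of a vertex is copied letter by letter through \<open>f\<close>;
  cancellation of a repeated colour is respected. With \<open>f\<close> the identity this gives
  colour-preserving maps from any vertex to any other, which reduce questions about half-trees to
  \<open>origin\<close>; with \<open>f\<close> in \<open>F\<close> it gives lifts of local
  actions.\<close>

lemma ex_constant_local:
  "\<exists>g. (\<forall>v d. g (nb v d) = nb (g v) (f d)) \<and> g u = u'"
proof (induction u arbitrary: u' rule: vert_induct)
  case origin
  define g where "g v = foldr (\<lambda>d x. nb x (f d)) (word v) u'" for v
  have "g (nb v d) = nb (g v) (f d)" for v d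
    by (auto simp: g_def word_nb split: list.splits)
  moreover have "g origin = u'" by (simp add: g_def)
  ultimately show ?case by blast
next
  case (nb v d)
  \<comment> \<open>The image of \<open>v\<close> is prescribed so that its neighbour of colour
    \<open>f d\<close> is the desired \<open>u'\<close>.\<close>
  from nb[of "nb u' (f d)"] obtain g
    where g: "\<forall>v d. g (nb v d) = nb (g v) (f d)" "g v = nb u' (f d)" by blast
  then have "g (nb v d) = u'" by simp
  then show ?case using g(1) by blast
qed

section \<open>Half-trees\<close>

text \<open>A pair of a vertex and a colour stands for a directed edge; \<open>away\<close> is
  reachability of directed edges without backtracking. No base point enters, so automorphisms
  transport half-trees directly.\<close>

inductive away :: "vert \<Rightarrow> nat \<Rightarrow> vert \<Rightarrow> nat \<Rightarrow> bool" for v d where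
  away_base: "away v d v d"
| away_step: "away v d w c \<Longrightarrow> c' \<noteq> c \<Longrightarrow> away v d (nb w c) c'"

definition half :: "vert \<Rightarrow> nat \<Rightarrow> vert set" where
  "half v d = {nb w c | w c. away v d w c}"

lemma away_half: "away v d w c \<Longrightarrow> nb w c \<in> half v d"
  by (auto simp: half_def)

lemma away_trans: "away v d w c \<Longrightarrow> away u e v d \<Longrightarrow> away u e w c"
  by (induction rule: away.induct) (auto intro: away.intros)

lemma tip_half [simp]: "nb v d \<in> half v d"
  by (auto intro: away_half away.intros)

lemma half_nb:
  assumes "w \<in> half v d"
  shows "nb w c \<in> half v d \<or> w = nb v d \<and> c = d"
proof -
  from assms obtain w' c' where w: "w = nb w' c'" "away v d w' c'"
    by (auto simp: half_def)
  show ?thesis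
  proof (cases "c = c'")
    case True
    from w(2) show ?thesis
    proof cases
      case away_base
      then show ?thesis using w True by auto
    next
      case (away_step w'' c'')
      then show ?thesis using w True by (auto intro: away_half)
    qed
  next
    case False
    then show ?thesis using w by (auto intro: away_half away_step)
  qed
qed

lemma away_constant_local:
  assumes "\<And>v d. g (nb v d) = nb (g v) d"
  shows "away v d w c \<Longrightarrow> away (g v) d (g w) c"
  by (induction rule: away.induct) (auto simp: assms intro: away.intros)

text \<open>Here acyclicity of the tree enters: along a path without backtracking from
  \<open>origin\<close> the words only grow, and their last letter keeps the colour of the initial
  edge.\<close>

lemma away_origin:
  "away origin d w c \<Longrightarrow> word (nb w c) = c # word w \<and> last (c # word w) = d"
proof (induction rule: away.induct)
  case away_base
  then show ?case by (simp add: word_nb)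
next
  case (away_step w c c')
  then show ?case by (subst word_nb) auto
qed

lemma origin_notin_half [simp]: "v \<notin> half v d"
proof
  assume "v \<in> half v d"
  then obtain w c where w: "v = nb w c" "away v d w c" by (auto simp: half_def)
  obtain g where g: "\<And>v d. g (nb v d) = nb (g v) d" "g v = origin"
    using ex_constant_local[of "\<lambda>d. d" v origin] by auto
  have "away origin d (g w) c" using away_constant_local[OF g(1) w(2)] g(2) by simp
  from away_origin[OF this] show False using g w(1) by (metis list.distinct(1) word_origin)
qed

lemma away_tip:
  assumes "away v d w c" "nb w c = nb v d"
  shows "w = v \<and> c = d"
proof -
  obtain g where g: "\<And>v d. g (nb v d) = nb (g v) d" "g v = origin"
    using ex_constant_local[of "\<lambda>d. d" v origin] by auto
  have "away origin d (g w) c" using away_constant_local[OF g(1) assms(1)] g(2) by simp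
  from away_origin[OF this] have "word (nb (g w) c) = c # word (g w)" by simp
  moreover have "nb (g w) c = nb origin d" using assms(2) g by metis
  ultimately have "c = d" by (simp add: word_nb)
  then show ?thesis using assms(2) by (metis nb_nb)
qed

text \<open>A half-tree can be entered only over its root edge, hence from \<open>v\<close> in
  colour \<open>d\<close>. By \<open>away_tip\<close> the path would have just arrived at
  \<open>v\<close> along that very edge, so it would backtrack.\<close>

lemma half_opposite_disjoint:
  assumes "w \<in> half (nb v d) d"
  shows "w \<notin> half v d"
proof -
  have "nb w' c' \<notin> half v d" if "away (nb v d) d w' c'" for w' c'
    using that
  proof (induction rule: away.induct)
    case (away_step w' c c')
    show ?case
    proof
      assume *: "nb (nb w' c) c' \<in> half v d"
      from half_nb[OF *, of c'] away_step.IH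
      have "nb (nb w' c) c' = nb v d" "c' = d" by auto
      then have "nb w' c = v" by (metis nb_nb)
      then have "c = d" using away_tip[OF away_step.hyps(1)] by simp
      then show False using away_step.hyps \<open>c' = d\<close> by simp
    qed
  qed simp
  then show ?thesis using assms by (auto simp: half_def)
qed

lemma half_subset_opposite: "d' \<noteq> d \<Longrightarrow> half v d' \<subseteq> half (nb v d) d"
  using away_step[OF away_base, of d' d "nb v d"] by (auto simp: half_def dest: away_trans)

lemma half_cover: "w = v \<or> (\<exists>d. w \<in> half v d)"
proof (induction w rule: vert_induct_from[where u = v])
  case (nb w c)
  then consider "w = v" | d where "w \<in> half v d" by blast
  then show ?case
  proof cases
    case 1
    then show ?thesis by (auto intro: tip_half)
  next
    case 2
    then show ?thesis using half_nb[of w v d c] by auto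
  qed
qed simp

lemma half_opposite: "half (nb v d) d = - half v d"
proof -
  have "w \<in> half (nb v d) d" if "w \<notin> half v d" for w
  proof -
    consider "w = v" | d' where "w \<in> half v d'" using half_cover by blast
    then show ?thesis
    proof cases
      case 1
      then show ?thesis using tip_half[of "nb v d" d] by simp
    next
      case 2
      then show ?thesis using half_subset_opposite[of d' d v] that by blast
    qed
  qed
  then show ?thesis using half_opposite_disjoint by blast
qed

lemma half_unique: "w \<in> half v d \<Longrightarrow> w \<in> half v d' \<Longrightarrow> d = d'"
  using half_subset_opposite half_opposite_disjoint by blast

lemma half_disjoint_colour: "d \<noteq> d' \<Longrightarrow> half v d \<inter> half v d' = {}"
  using half_unique by blast

lemma half_cross: "nb w c \<in> half v d \<Longrightarrow> w \<notin> half v d \<Longrightarrow> w = v \<and> c = d"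
  using half_nb[of "nb w c" v d c] by (metis nb_nb)

lemma half_disjoint:
  assumes "v \<notin> half u e" "u \<notin> half v d" "u \<noteq> v"
  shows "half u e \<inter> half v d = {}"
proof -
  have "nb w c \<notin> half v d" if "away u e w c" for w c
    using that
  proof (induction rule: away.induct)
    case away_base
    then show ?case using half_cross assms by blast
  next
    case (away_step w c c')
    then show ?case using half_cross[of "nb w c" c' v d] assms(1) away_half by blast
  qed
  then show ?thesis by (auto simp: half_def[of u])
qed

lemma half_mono:
  assumes "u \<in> half v d" "v \<notin> half u e"
  shows "half u e \<subseteq> half v d"
proof -
  have "w \<in> half v d \<and> nb w c \<in> half v d" if "away u e w c" for w c
    using that
  proof (induction rule: away.induct)
    case away_base
    then show ?case using half_nb[OF assms(1), of e] assms tip_half[of "nb v d" d] by auto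
  next
    case (away_step w c c')
    then have "away u e (nb w c) c'" by (auto intro: away.intros)
    then have "nb (nb w c) c' \<noteq> v" using assms(2) away_half by metis
    then show ?case using half_nb[of "nb w c" v d c'] away_step.IH by auto
  qed
  then show ?thesis by (auto simp: half_def[of u])
qed

section \<open>Local actions and the universal group\<close>

definition loc :: "(vert \<Rightarrow> vert) \<Rightarrow> vert \<Rightarrow> (nat \<Rightarrow> nat) \<Rightarrow> bool" where
  "loc g v f \<longleftrightarrow> (\<forall>d. g (nb v d) = nb (g v) (f d))"

lemma loc_nb: "loc g v f \<Longrightarrow> g (nb v d) = nb (g v) (f d)"
  by (simp add: loc_def)

lemma loc_unique: "loc g v f \<Longrightarrow> loc g v f' \<Longrightarrow> f = f'"
  by (auto simp: loc_def fun_eq_iff)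

lemma loc_id: "loc id v id"
  by (simp add: loc_def)

lemma loc_comp: "loc h v f \<Longrightarrow> loc g (h v) f' \<Longrightarrow> loc (g \<circ> h) v (f' \<circ> f)"
  by (simp add: loc_def)

lemma loc_inv:
  assumes "bij g" "bij f" "loc g v f"
  shows "loc (inv g) (g v) (inv f)"
proof -
  have "inv g (nb (g v) d) = nb v (inv f d)" for d
  proof -
    have "g (nb v (inv f d)) = nb (g v) d"
      using assms by (simp add: loc_def bij_is_surj surj_f_inv_f)
    then show ?thesis using assms(1) by (metis bij_inv_eq_iff)
  qed
  then show ?thesis using assms(1) by (simp add: loc_def bij_is_inj inv_f_f)
qed

lemma loc_edge:
  assumes "loc g v f" "loc g (nb v d) f'"
  shows "f' d = f d"
proof -
  have "nb (g (nb v d)) (f' d) = g v" using loc_nb[OF assms(2), of d] by simp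
  also have "\<dots> = nb (g (nb v d)) (f d)" using loc_nb[OF assms(1), of d] by simp
  finally show ?thesis by simp
qed

locale perm_group =
  fixes F :: "(nat \<Rightarrow> nat) set"
  assumes id_F: "id \<in> F"
    and comp_F: "f \<in> F \<Longrightarrow> g \<in> F \<Longrightarrow> f \<circ> g \<in> F"
    and bij_F: "f \<in> F \<Longrightarrow> bij f"
    and inv_F: "f \<in> F \<Longrightarrow> inv f \<in> F"
begin

definition U :: "(vert \<Rightarrow> vert) set" where
  "U = {g. \<forall>v. \<exists>f\<in>F. loc g v f}"

definition G :: "(vert \<Rightarrow> vert) set" where
  "G = {g \<in> U. \<forall>v. par (g v) = par v}"

definition Gm :: "(vert \<Rightarrow> vert) monoid" where
  "Gm = \<lparr>carrier = G, mult = (\<circ>), one = id\<rparr>"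

text \<open>The rigid stabiliser of a half-tree: the subgroups on which Tits' argument
  operates.\<close>

definition K :: "vert \<Rightarrow> nat \<Rightarrow> (vert \<Rightarrow> vert) set" where
  "K v d = {g \<in> G. \<forall>w. w \<notin> half v d \<longrightarrow> g w = w}"

lemma U_E: "g \<in> U \<Longrightarrow> (\<And>f. f \<in> F \<Longrightarrow> loc g v f \<Longrightarrow> thesis) \<Longrightarrow> thesis"
  by (auto simp: U_def)

lemma U_loc_F: "g \<in> U \<Longrightarrow> loc g v f \<Longrightarrow> f \<in> F"
  by (metis U_E loc_unique)

text \<open>Membership in \<open>U\<close> is a condition on each vertex with its neighbours, so
  maps may be assembled piecewise. This is the source of the independence property.\<close>

lemma U_local:
  assumes "\<And>v. \<exists>g\<in>U. x v = g v \<and> (\<forall>d. x (nb v d) = g (nb v d))"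
  shows "x \<in> U"
proof -
  have "\<exists>f\<in>F. loc x v f" for v
  proof -
    obtain g where g: "g \<in> U" "x v = g v" "\<And>d. x (nb v d) = g (nb v d)" using assms by blast
    obtain f where f: "f \<in> F" "loc g v f" using g(1) by (rule U_E)
    then have "loc x v f" using g by (simp add: loc_def)
    then show ?thesis using f by blast
  qed
  then show ?thesis by (auto simp: U_def)
qed

lemma U_away:
  assumes "g \<in> U" "loc g v f" "away v d w c" "loc g w f'"
  shows "away (g v) (f d) (g w) (f' c)"
  using assms(3,4)
proof (induction arbitrary: f' rule: away.induct)
  case away_base
  then have "f' = f" using loc_unique assms(2) by blast
  then show ?case by (auto intro: away.intros)
next
  case (away_step w c c')
  obtain f'' where f'': "f'' \<in> F" "loc g w f''" using assms(1) by (rule U_E)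
  have "f' c = f'' c" using loc_edge[OF f''(2) away_step.prems] .
  moreover have "inj f'" using U_loc_F[OF assms(1) away_step.prems] bij_F bij_is_inj by blast
  then have "f' c' \<noteq> f' c" using \<open>c' \<noteq> c\<close> by (simp add: inj_eq)
  ultimately show ?case
    using away.away_step[OF away_step.IH[OF f''(2)], of "f' c'"] loc_nb[OF f''(2), of c] by simp
qed

lemma U_half: "g \<in> U \<Longrightarrow> loc g v f \<Longrightarrow> w \<in> half v d \<Longrightarrow> g w \<in> half (g v) (f d)"
proof -
  assume g: "g \<in> U" "loc g v f" and "w \<in> half v d"
  then obtain w' c where w: "w = nb w' c" "away v d w' c" by (auto simp: half_def)
  obtain f' where f': "loc g w' f'" using g(1) by (rule U_E)
  show ?thesis using away_half[OF U_away[OF g w(2) f']] loc_nb[OF f'] w(1) by simp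
qed

text \<open>Injective: a vertex other than \<open>w\<close> lies in some half-tree at
  \<open>w\<close>, and its image lies in a half-tree at \<open>g w\<close>, which omits
  \<open>g w\<close>. Surjective: local actions are onto, so the range is closed under passing to
  neighbours.\<close>

lemma bij_U:
  assumes "g \<in> U"
  shows "bij g"
proof (rule bijI)
  show "inj g"
  proof (rule injI)
    fix w w' assume "g w = g w'"
    obtain f where f: "loc g w f" using assms by (rule U_E)
    show "w = w'"
    proof (rule ccontr)
      assume "w \<noteq> w'"
      then obtain d where "w' \<in> half w d" using half_cover by metis
      from U_half[OF assms f this] show False using \<open>g w = g w'\<close> by simp
    qed
  qed
  have "v \<in> range g" for v
  proof (induction v rule: vert_induct_from[where u = "g origin"])
    case (nb v d)
    then obtain w where w: "v = g w" by auto
    obtain f where f: "f \<in> F" "loc g w f" using assms by (rule U_E)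
    then have "g (nb w (inv f d)) = nb v d"
      using w bij_F by (simp add: loc_def bij_is_surj surj_f_inv_f)
    then show ?case by (metis rangeI)
  qed simp
  then show "surj g" by blast
qed

text \<open>The complement of a half-tree is the half-tree on the other side of the same edge, so
  the converse is \<open>U_half\<close> for the opposite side; \<open>loc_edge\<close> identifies
  the image of the reversed edge.\<close>

lemma U_half_iff:
  assumes "g \<in> U" "loc g v f"
  shows "g w \<in> half (g v) (f d) \<longleftrightarrow> w \<in> half v d"
proof -
  have "g w \<notin> half (g v) (f d)" if "w \<notin> half v d"
  proof -
    from that have w: "w \<in> half (nb v d) d" by (simp add: half_opposite)
    obtain f' where f': "loc g (nb v d) f'" using assms(1) by (rule U_E)
    have "g w \<in> half (nb (g v) (f d)) (f d)"
      using U_half[OF assms(1) f' w] loc_edge[OF assms(2) f'] loc_nb[OF assms(2), of d] by simp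
    then show ?thesis by (simp add: half_opposite)
  qed
  then show ?thesis using U_half[OF assms] by blast
qed

lemma id_U: "id \<in> U"
  using id_F loc_id by (auto simp: U_def)

lemma comp_U: "g \<in> U \<Longrightarrow> h \<in> U \<Longrightarrow> g \<circ> h \<in> U"
  unfolding U_def using loc_comp comp_F by blast

lemma inv_U:
  assumes "g \<in> U"
  shows "inv g \<in> U"
proof -
  have "\<exists>f\<in>F. loc (inv g) v f" for v
  proof -
    obtain f where f: "f \<in> F" "loc g (inv g v) f" using assms by (rule U_E)
    have "loc (inv g) (g (inv g v)) (inv f)"
      using loc_inv[OF bij_U[OF assms] bij_F[OF f(1)] f(2)] .
    then show ?thesis using inv_F f(1) bij_U[OF assms] by (auto simp: bij_is_surj surj_f_inv_f)
  qed
  then show ?thesis by (auto simp: U_def)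
qed

lemma G_U: "g \<in> G \<Longrightarrow> g \<in> U"
  by (simp add: G_def)

lemma bij_G: "g \<in> G \<Longrightarrow> bij g"
  by (simp add: G_U bij_U)

lemma G_par: "g \<in> G \<Longrightarrow> par (g v) = par v"
  by (simp add: G_def)

lemma id_G: "id \<in> G"
  by (simp add: G_def id_U)

lemma comp_G: "g \<in> G \<Longrightarrow> h \<in> G \<Longrightarrow> g \<circ> h \<in> G"
  by (simp add: G_def comp_U)

lemma inv_apply [simp]: "g \<in> G \<Longrightarrow> inv g (g w) = w"
  by (simp add: bij_G bij_is_inj)

lemma apply_inv [simp]: "g \<in> G \<Longrightarrow> g (inv g w) = w"
  by (simp add: bij_G bij_is_surj surj_f_inv_f)

lemma inv_G:
  assumes "g \<in> G"
  shows "inv g \<in> G"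
proof -
  have "par (inv g v) = par v" for v
    using G_par[OF assms, of "inv g v"] assms by simp
  then show ?thesis using inv_U[OF G_U[OF assms]] by (simp add: G_def)
qed

lemma G_E: "g \<in> G \<Longrightarrow> (\<And>f. f \<in> F \<Longrightarrow> loc g v f \<Longrightarrow> thesis) \<Longrightarrow> thesis"
  by (meson G_U U_E)

lemma loc_inv_G: "g \<in> G \<Longrightarrow> loc g v f \<Longrightarrow> loc (inv g) (g v) (inv f)"
  using G_U U_loc_F bij_F bij_G loc_inv by blast

lemma G_I:
  assumes "g \<in> U" "par (g u) = par u"
  shows "g \<in> G"
proof -
  have "par (g v) = par v" for v
  proof (induction v rule: vert_induct_from[where u = u])
    case (nb v d)
    obtain f where "loc g v f" using assms(1) by (rule U_E)
    then show ?case using nb by (simp add: loc_nb)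
  qed (rule assms)
  then show ?thesis using assms by (simp add: G_def)
qed

lemma group_Gm: "group Gm"
proof (rule groupI)
  fix g assume "g \<in> carrier Gm"
  then show "\<exists>h\<in>carrier Gm. h \<otimes>\<^bsub>Gm\<^esub> g = \<one>\<^bsub>Gm\<^esub>"
    by (intro bexI[of _ "inv g"]) (auto simp: Gm_def inv_G)
qed (auto simp: Gm_def comp_G id_G)

lemma carrier_Gm [simp]: "carrier Gm = G"
  and mult_Gm [simp]: "g \<otimes>\<^bsub>Gm\<^esub> h = g \<circ> h"
  and one_Gm [simp]: "\<one>\<^bsub>Gm\<^esub> = id"
  by (simp_all add: Gm_def)

lemma inv_Gm: "g \<in> G \<Longrightarrow> m_inv Gm g = inv g"
  using group.inv_equality[OF group_Gm, of "inv g" g] by (simp add: inv_G bij_G bij_is_inj)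

lemma ex_G_constant_local:
  assumes "f \<in> F" "par u' = par u"
  shows "\<exists>g\<in>G. g u = u' \<and> (\<forall>v. loc g v f)"
proof -
  obtain g where g: "\<And>v d. g (nb v d) = nb (g v) (f d)" "g u = u'"
    using ex_constant_local by blast
  then have "loc g v f" for v by (simp add: loc_def)
  then have "g \<in> U" "\<forall>v. loc g v f" using assms(1) by (auto simp: U_def)
  then show ?thesis using G_I[of g u] g(2) assms(2) by blast
qed

text \<open>Tits' independence property: an element fixing both ends of an edge may be kept on one
  side and replaced by the identity on the other, since around every vertex the result agrees with
  one of the two.\<close>

lemma cut_G:
  assumes "g \<in> G" "g v = v" "g (nb v d) = nb v d"
  shows "(\<lambda>w. if w \<in> half v d then g w else w) \<in> K v d" (is "?x \<in> _")
proof -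
  have "\<exists>h\<in>U. ?x w = h w \<and> (\<forall>c. ?x (nb w c) = h (nb w c))" for w
  proof (cases "w \<in> half v d")
    case True
    have "?x (nb w c) = g (nb w c)" for c
      using half_nb[OF True, of c] assms by auto
    then show ?thesis using True G_U[OF assms(1)] by auto
  next
    case False
    have "?x (nb w c) = nb w c" for c
      using half_cross[of w c v d] False assms by auto
    then show ?thesis using False id_U by (intro bexI[of _ id]) auto
  qed
  then have "?x \<in> U" by (rule U_local)
  then have "?x \<in> G" by (rule G_I[of _ v]) simp
  then show ?thesis by (simp add: K_def)
qed

text \<open>The local action at \<open>v\<close> fixes every colour except possibly
  \<open>d\<close>, and an injective map cannot move just one colour.\<close>

lemma K_tip:
  assumes "g \<in> K v d"
  shows "g (nb v d) = nb v d"
proof -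
  have g: "g \<in> G" "\<And>w. w \<notin> half v d \<Longrightarrow> g w = w" using assms by (auto simp: K_def)
  obtain f where f: "f \<in> F" "loc g v f" using g(1) by (rule G_E)
  have fc: "f c = c" if "c \<noteq> d" for c
  proof -
    have "nb v c \<notin> half v d" using that half_unique tip_half by blast
    then have "nb v c = nb v (f c)" using g(2)[of "nb v c"] g(2)[of v] loc_nb[OF f(2), of c] by simp
    then show ?thesis by simp
  qed
  have "f d = d"
  proof (rule ccontr)
    assume "f d \<noteq> d"
    then have "f (f d) = f d" by (rule fc)
    then show False using \<open>f d \<noteq> d\<close> bij_F[OF f(1)] by (simp add: bij_is_inj inj_eq)
  qed
  then show ?thesis using loc_nb[OF f(2), of d] g(2)[of v] by simp
qed

lemma K_half: "g \<in> K v d \<Longrightarrow> w \<in> half v d \<Longrightarrow> g w \<in> half v d"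
  by (metis (mono_tags, lifting) K_def bij_G bij_is_inj inj_eq mem_Collect_eq)

lemma K_conj:
  assumes "g \<in> K v d" "t \<in> G" "loc t v f"
  shows "t \<circ> g \<circ> inv t \<in> K (t v) (f d)"
proof -
  have "(t \<circ> g \<circ> inv t) w = w" if "w \<notin> half (t v) (f d)" for w
  proof -
    have "inv t w \<notin> half v d"
      using that U_half_iff[OF G_U[OF assms(2)] assms(3), of "inv t w" d] assms(2) by simp
    then show ?thesis using assms by (simp add: K_def)
  qed
  then show ?thesis using assms by (simp add: K_def comp_G inv_G)
qed

text \<open>Infinitely many factors are admissible because membership is tested around one vertex at
  a time. An edge leading into a half-tree from outside ends at its tip, which is fixed by
  \<open>K_tip\<close>, so the pieces agree along their borders.\<close>

lemma paste_G:
  assumes a: "\<And>i. a i \<in> K (v i) (d i)"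
    and disj: "\<And>i j. i \<noteq> j \<Longrightarrow> half (v i) (d i) \<inter> half (v j) (d j) = {}"
    and x: "\<And>i w. w \<in> half (v i) (d i) \<Longrightarrow> x w = a i w"
    and x': "\<And>w. (\<And>i. w \<notin> half (v i) (d i)) \<Longrightarrow> x w = w"
  shows "x \<in> G"
proof -
  have aG: "a i \<in> G" and afix: "w \<notin> half (v i) (d i) \<Longrightarrow> a i w = w" for i w
    using a by (auto simp: K_def)
  have enter: "x (nb w c) = nb w c" if "nb w c \<in> half (v i) (d i)" "w \<notin> half (v i) (d i)" for w c i
    using half_cross[OF that] K_tip[OF a[of i]] x[OF that(1)] by simp
  have "\<exists>h\<in>U. x w = h w \<and> (\<forall>c. x (nb w c) = h (nb w c))" for w
  proof (cases "\<exists>i. w \<in> half (v i) (d i)")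
    case True
    then obtain i where i: "w \<in> half (v i) (d i)" by blast
    have "x (nb w c) = a i (nb w c)" for c
    proof (cases "nb w c \<in> half (v i) (d i)")
      case False
      have "x (nb w c) = nb w c"
      proof (cases "\<exists>j. nb w c \<in> half (v j) (d j)")
        case True
        then obtain j where j: "nb w c \<in> half (v j) (d j)" by blast
        then have "w \<notin> half (v j) (d j)" using False i disj[of i j] by auto
        then show ?thesis using enter j by blast
      qed (use x' in blast)
      then show ?thesis using afix False by simp
    qed (rule x)
    then show ?thesis using x[OF i] aG G_U by blast
  next
    case False
    have "x (nb w c) = nb w c" for c
      using enter x' False by blast
    then show ?thesis using False x' id_U by (intro bexI[of _ id]) auto
  qed
  then have "x \<in> U" by (rule U_local)
  moreover have "par (x origin) = par origin"
    using x x' aG G_par by (cases "\<exists>i. origin \<in> half (v i) (d i)") fastforce+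
  ultimately show ?thesis by (rule G_I)
qed

end

section \<open>Generation by vertex stabilisers and simplicity\<close>

locale tree_group = perm_group +
  assumes trans_F: "\<exists>f\<in>F. f x = y"
    and finite_stab: "finite {f \<in> F. f x = x}"
    and nontrivial_stab: "\<exists>f\<in>F. f x = x \<and> f \<noteq> id"
    and gen_stab: "perm_group J \<Longrightarrow> J \<subseteq> F \<Longrightarrow> (\<And>f x. f \<in> F \<Longrightarrow> f x = x \<Longrightarrow> f \<in> J) \<Longrightarrow> J = F"
    and finitely_generated:
      "\<exists>A. finite A \<and> A \<subseteq> F \<and> (\<forall>J. perm_group J \<longrightarrow> J \<subseteq> F \<longrightarrow> A \<subseteq> J \<longrightarrow> J = F)"
begin

section \<open>Generation of the group by vertex and edge data\<close>

lemma subgroup_GmD: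
  assumes "subgroup J Gm"
  shows "J \<subseteq> G" "id \<in> J" "g \<in> J \<Longrightarrow> h \<in> J \<Longrightarrow> g \<circ> h \<in> J" "g \<in> J \<Longrightarrow> inv g \<in> J"
proof -
  show J: "J \<subseteq> G" using subgroup.subset[OF assms] by simp
  show "id \<in> J" using subgroup.one_closed[OF assms] by simp
  show "g \<in> J \<Longrightarrow> h \<in> J \<Longrightarrow> g \<circ> h \<in> J" using subgroup.m_closed[OF assms] by simp
  show "g \<in> J \<Longrightarrow> inv g \<in> J" using subgroup.m_inv_closed[OF assms] J inv_Gm by fastforce
qed

text \<open>Generation of \<open>F\<close> is lifted to the stabiliser of \<open>u\<close>: the
  local actions all of whose realisations at \<open>u\<close> lie in \<open>J\<close> form a
  permutation group. Closure under products works because one chosen realisation of \<open>f\<close>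
  can be split off from any realisation of \<open>f \<circ> f'\<close>.\<close>

lemma vertex_stabiliser_subset:
  assumes J: "subgroup J Gm"
    and B: "\<And>J'. perm_group J' \<Longrightarrow> J' \<subseteq> F \<Longrightarrow> B \<subseteq> J' \<Longrightarrow> J' = F" "B \<subseteq> F"
    and BJ: "\<And>f g. f \<in> B \<Longrightarrow> g \<in> G \<Longrightarrow> g u = u \<Longrightarrow> loc g u f \<Longrightarrow> g \<in> J"
    and id: "\<And>g. g \<in> G \<Longrightarrow> g u = u \<Longrightarrow> loc g u id \<Longrightarrow> g \<in> J"
    and g: "g \<in> G" "g u = u"
  shows "g \<in> J"
proof -
  note J = subgroup_GmD[OF J]
  define J' where "J' = {f \<in> F. \<forall>g\<in>G. g u = u \<longrightarrow> loc g u f \<longrightarrow> g \<in> J}"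
  have "perm_group J'"
  proof
    show "id \<in> J'" using id id_F by (simp add: J'_def)
    fix f assume f: "f \<in> J'"
    then have fF: "f \<in> F" by (simp add: J'_def)
    then show "bij f" by (rule bij_F)
    have "g \<in> J" if g: "g \<in> G" "g u = u" "loc g u (inv f)" for g
    proof -
      have "loc (inv g) (g u) (inv (inv f))" using loc_inv_G g by blast
      then have "loc (inv g) u f" using g bij_F[OF fF] by (simp add: inv_inv_eq)
      moreover have "inv g u = u" using g by (metis inv_apply)
      ultimately have "inv g \<in> J" using f inv_G[OF g(1)] by (simp add: J'_def)
      then show ?thesis using J(4)[of "inv g"] bij_G[OF g(1)] by (simp add: inv_inv_eq)
    qed
    then show "inv f \<in> J'" using inv_F[OF fF] by (simp add: J'_def)
    fix f' assume f': "f' \<in> J'"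
    then have fF': "f' \<in> F" by (simp add: J'_def)
    have "g \<in> J" if g: "g \<in> G" "g u = u" "loc g u (f \<circ> f')" for g
    proof -
      obtain h where h: "h \<in> G" "h u = u" "loc h u f"
        using ex_G_constant_local[OF fF, of u u] by auto
      have hJ: "h \<in> J" using h f by (simp add: J'_def)
      have "loc (inv h) (h u) (inv f)" using h loc_inv_G by blast
      then have "loc (inv h \<circ> g) u (inv f \<circ> (f \<circ> f'))" using loc_comp[OF g(3)] g h by simp
      moreover have "inv f \<circ> (f \<circ> f') = f'"
        using bij_F[OF fF] by (simp add: fun_eq_iff bij_is_inj)
      moreover have "inv h u = u" using h by (metis inv_apply)
      ultimately have "inv h \<circ> g \<in> J"
        using f' comp_G[OF inv_G[OF h(1)] g(1)] g(2) by (simp add: J'_def)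
      from J(3)[OF hJ this] have "h \<circ> (inv h \<circ> g) \<in> J" .
      moreover have "h \<circ> (inv h \<circ> g) = g" using h by (simp add: fun_eq_iff)
      ultimately show ?thesis by simp
    qed
    then show "f \<circ> f' \<in> J'" using comp_F[OF fF fF'] by (simp add: J'_def)
  qed
  then have "J' = F" by (rule B(1)) (use B(2) BJ in \<open>auto simp: J'_def\<close>)
  obtain f where "f \<in> F" "loc g u f" using g(1) by (rule G_E)
  then show ?thesis using \<open>J' = F\<close> g by (auto simp: J'_def)
qed

lemma ex_stabiliser_move:
  "\<exists>g\<in>G. g u = u \<and> g (nb u d) = nb u e"
proof -
  obtain f where "f \<in> F" "f d = e" using trans_F by blast
  then show ?thesis using ex_G_constant_local[of f u u] loc_nb by metis
qed

text \<open>It suffices that \<open>J\<close> is transitive on even vertices. Two even neighbours of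
  an odd vertex are exchanged by rotating about it; hence at odd vertices the induction only claims
  that some neighbour lies in the orbit of \<open>origin\<close>.\<close>

lemma eq_G_if_stabilisers:
  assumes J: "subgroup J Gm" and stab: "\<And>g u. g \<in> G \<Longrightarrow> g u = u \<Longrightarrow> g \<in> J"
  shows "J = G"
proof
  note J = subgroup_GmD[OF J]
  show "J \<subseteq> G" by (rule J)
  have orbit: "if par v then \<exists>h\<in>J. h origin = v else \<exists>h\<in>J. \<exists>e. h origin = nb v e" for v
  proof (induction v rule: vert_induct)
    case origin
    show ?case using J(2) by (auto intro!: bexI[of _ id])
  next
    case (nb v d)
    show ?case
    proof (cases "par v")
      case True
      then show ?thesis using nb by (auto intro!: exI[of _ d])
    next
      case False
      then obtain h e where h: "h \<in> J" "h origin = nb v e" using nb by auto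
      obtain k where k: "k \<in> G" "k v = v" "k (nb v e) = nb v d" using ex_stabiliser_move by blast
      have "k \<circ> h \<in> J" using J(3) stab[OF k(1,2)] h(1) by blast
      moreover have "(k \<circ> h) origin = nb v d" using h k by simp
      ultimately show ?thesis using False by (auto intro!: bexI[of _ "k \<circ> h"])
    qed
  qed
  show "G \<subseteq> J"
  proof
    fix g assume g: "g \<in> G"
    have "par (g origin)" using G_par[OF g, of origin] by simp
    then obtain h where h: "h \<in> J" "h origin = g origin" using orbit[of "g origin"] by auto
    then have hG: "h \<in> G" using J by blast
    have "(inv h \<circ> g) origin = origin" using h(2) inv_apply[OF hG, of origin] by simp
    then have "inv h \<circ> g \<in> J" using stab comp_G[OF inv_G[OF hG] g] by blast
    from J(3)[OF h(1) this] have "h \<circ> (inv h \<circ> g) \<in> J" .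
    moreover have "h \<circ> (inv h \<circ> g) = g" using hG by (simp add: fun_eq_iff)
    ultimately show "g \<in> J" by simp
  qed
qed

lemma stabiliser_transport:
  assumes J: "subgroup J Gm" and "k \<in> J" "k u = u'"
    and stab: "\<And>g. g \<in> G \<Longrightarrow> g u = u \<Longrightarrow> g \<in> J"
    and g: "g \<in> G" "g u' = u'"
  shows "g \<in> J"
proof -
  note J = subgroup_GmD[OF J]
  have kG: "k \<in> G" using J assms by blast
  have "(inv k \<circ> g \<circ> k) u = u" using assms(3) g(2) inv_apply[OF kG, of u] by simp
  then have "inv k \<circ> g \<circ> k \<in> J" using stab g kG by (simp add: comp_G inv_G)
  then have "k \<circ> (inv k \<circ> g \<circ> k) \<circ> inv k \<in> J"
    using J(3)[OF J(3)[OF assms(2)] J(4)[OF assms(2)]] by blast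
  moreover have "k \<circ> (inv k \<circ> g \<circ> k) \<circ> inv k = g" using kG by (simp add: fun_eq_iff)
  ultimately show ?thesis by simp
qed

text \<open>The claim spreads over the tree when stated for a vertex together with all its
  neighbours: rotation about \<open>nb u d\<close>, already in \<open>J\<close>, conjugates the
  stabiliser of \<open>u\<close> to that of every other neighbour of \<open>nb u d\<close>.\<close>

lemma eq_G_if_edge_stabilisers:
  assumes J: "subgroup J Gm"
    and "\<And>g. g \<in> G \<Longrightarrow> g origin = origin \<Longrightarrow> g \<in> J"
    and "\<And>g. g \<in> G \<Longrightarrow> g (nb origin e) = nb origin e \<Longrightarrow> g \<in> J"
  shows "J = G"
proof -
  have "(\<forall>g\<in>G. g u = u \<longrightarrow> g \<in> J) \<and> (\<forall>d. \<forall>g\<in>G. g (nb u d) = nb u d \<longrightarrow> g \<in> J)" for u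
  proof (induction u rule: vert_induct)
    case origin
    have "g \<in> J" if "g \<in> G" "g (nb origin d) = nb origin d" for g d
    proof -
      obtain k where k: "k \<in> G" "k origin = origin" "k (nb origin e) = nb origin d"
        using ex_stabiliser_move by blast
      show ?thesis
        by (rule stabiliser_transport[where k = k and u = "nb origin e" and u' = "nb origin d"])
          (use J k that assms in auto)
    qed
    then show ?case using assms by blast
  next
    case (nb u d)
    have "g \<in> J" if "g \<in> G" "g (nb (nb u d) c) = nb (nb u d) c" for g c
    proof -
      obtain k where k: "k \<in> G" "k (nb u d) = nb u d" "k (nb (nb u d) d) = nb (nb u d) c"
        using ex_stabiliser_move by blast
      then have ku: "k u = nb (nb u d) c" by simp
      show ?thesis
        by (rule stabiliser_transport[where k = k and u = u and u' = "nb (nb u d) c"])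
          (use J k ku that nb in auto)
    qed
    moreover have "\<forall>g\<in>G. g (nb u d) = nb u d \<longrightarrow> g \<in> J" using nb by simp
    ultimately show ?case by simp
  qed
  then show ?thesis by (intro eq_G_if_stabilisers[OF J]) simp
qed

section \<open>Normal subgroups\<close>

lemma normal_GmD:
  assumes "N \<lhd> Gm"
  shows "subgroup N Gm" "g \<in> G \<Longrightarrow> h \<in> N \<Longrightarrow> g \<circ> h \<circ> inv g \<in> N"
proof -
  show "subgroup N Gm" by (rule normal_imp_subgroup[OF assms])
  show "g \<in> G \<Longrightarrow> h \<in> N \<Longrightarrow> g \<circ> h \<circ> inv g \<in> N"
    using normal.inv_op_closed2[OF assms, of g h] by (simp add: inv_Gm)
qed

lemma K_subset_normal_transport:
  assumes N: "N \<lhd> Gm" and "K u e \<subseteq> N" "par u' = par u"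
  shows "K u' e' \<subseteq> N"
proof
  fix g assume g: "g \<in> K u' e'"
  obtain f where f: "f \<in> F" "f e' = e" using trans_F by blast
  then obtain t where t: "t \<in> G" "t u' = u" "loc t u' f"
    using ex_G_constant_local[of f u u'] assms(3) by auto
  have "t \<circ> g \<circ> inv t \<in> N" using K_conj[OF g t(1,3)] t(2) f(2) assms(2) by auto
  then have "inv t \<circ> (t \<circ> g \<circ> inv t) \<circ> inv (inv t) \<in> N"
    using normal_GmD(2)[OF N] inv_G[OF t(1)] by blast
  moreover have "inv t \<circ> (t \<circ> g \<circ> inv t) \<circ> inv (inv t) = g"
    using t(1) bij_G[OF t(1)] by (simp add: fun_eq_iff inv_inv_eq)
  ultimately show "g \<in> N" by simp
qed

text \<open>Ping-pong: \<open>n\<close> moves a half-tree \<open>A\<close> off itself to \<open>A'\<close>; composing with a conjugate of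
  its inverse that moves the complement of a smaller half-tree \<open>Y \<subseteq> A\<close> into \<open>Y\<close> yields an
  element mapping the complement of \<open>Y\<close> into \<open>A'\<close>, hence strictly into itself.\<close>

lemma normal_translation:
  assumes N: "N \<lhd> Gm" and n: "n \<in> N" "n \<noteq> id"
  shows "\<exists>t\<in>N. \<exists>X p q. t ` X \<subseteq> X \<and> half p q \<subseteq> X \<and> half p q \<inter> t ` X = {}"
proof -
  note NJ = subgroup_GmD[OF normal_GmD(1)[OF N]]
  have nG: "n \<in> G" using n NJ by blast
  obtain v where v: "n v \<noteq> v" using n(2) by (auto simp: fun_eq_iff)
  obtain f where f: "f \<in> F" "loc n v f" using nG by (rule G_E)
  obtain c where c: "n v \<in> half v c" using half_cover v by metis
  obtain c' where c': "v \<in> half (n v) c'" using half_cover v by metis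
  \<comment> \<open>Seen from \<open>v\<close>, the colour \<open>d\<close> points away from
    \<open>n v\<close>; seen from \<open>n v\<close>, its image \<open>f d\<close> points away from
    \<open>v\<close>. Hence the two half-trees are disjoint.\<close>
  obtain d where "d \<notin> {c, inv f c'}" using ex_new_if_finite[of "{c, inv f c'}"] by auto
  then have d: "d \<noteq> c" "f d \<noteq> c'" using bij_F[OF f(1)] by (auto simp: bij_is_inj)
  define A where "A = half v d"
  define A' where "A' = half (n v) (f d)"
  define p where "p = nb v d"
  have "n v \<notin> half v d" using c d half_unique by blast
  moreover have "v \<notin> half (n v) (f d)" using c' d half_unique by blast
  ultimately have AA': "A \<inter> A' = {}" unfolding A_def A'_def using half_disjoint v by metis
  have nA: "n w \<in> A' \<longleftrightarrow> w \<in> A" for w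
    unfolding A_def A'_def using U_half_iff[OF G_U[OF nG] f(2)] .
  obtain q where q: "q \<notin> {d}" using ex_new_if_finite[of "{d}"] by auto
  obtain q' where q': "q' \<notin> {d, q}" using ex_new_if_finite[of "{d, q}"] by auto
  have sub: "half p r \<subseteq> A" if "r \<noteq> d" for r
  proof -
    have "v \<in> half p d" using tip_half[of p d] by (simp add: p_def)
    then have "v \<notin> half p r" using that half_unique by blast
    then show ?thesis unfolding A_def by (intro half_mono) (simp add: p_def)
  qed
  define Y where "Y = half p q"
  have YA: "Y \<subseteq> A" using sub q by (simp add: Y_def)
  have Yq': "half p q' \<inter> Y = {}" using q' half_disjoint_colour by (simp add: Y_def)
  \<comment> \<open>An element of \<open>G\<close> is sought that maps the complement of
    \<open>A'\<close>, itself a half-tree rooted at \<open>nb (n v) (f d)\<close>, onto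
    \<open>Y\<close>.\<close>
  obtain f0 where f0: "f0 \<in> F" "f0 (f d) = q" using trans_F by blast
  have "par p = par (nb (n v) (f d))" using G_par[OF nG] by (simp add: p_def)
  then obtain g where g: "g \<in> G" "g (nb (n v) (f d)) = p" "loc g (nb (n v) (f d)) f0"
    using ex_G_constant_local[OF f0(1)] by metis
  have gY: "g w \<in> Y \<longleftrightarrow> w \<notin> A'" for w
    using U_half_iff[OF G_U[OF g(1)] g(3), of w "f d"] f0(2) g(2)
    by (simp add: half_opposite A'_def Y_def)
  define m where "m = g \<circ> inv n \<circ> inv g"
  have m: "m w \<in> Y" if "w \<notin> Y" for w
  proof -
    have "inv g w \<in> A'" using that gY[of "inv g w"] g(1) by simp
    then have "inv n (inv g w) \<in> A" using nA[of "inv n (inv g w)"] nG by simp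
    then show ?thesis using gY AA' by (auto simp: m_def)
  qed
  have mN: "m \<in> N" unfolding m_def using normal_GmD(2)[OF N g(1)] NJ(4) n(1) by blast
  define t where "t = n \<circ> m"
  have "t \<in> N" unfolding t_def using NJ(3) n(1) mN by blast
  moreover have t: "t ` (- Y) \<subseteq> A'" using m YA nA by (auto simp: t_def)
  then have "t ` (- Y) \<subseteq> - Y" using YA AA' by blast
  \<comment> \<open>The witness for \<open>X\<close> is \<open>- Y\<close>. The half-tree
    \<open>half p q'\<close> lies in \<open>A\<close>, beside \<open>Y\<close>, while
    \<open>t\<close> pushes \<open>- Y\<close> into \<open>A'\<close>.\<close>
  moreover have "half p q' \<subseteq> - Y" using Yq' by blast
  moreover have "half p q' \<inter> t ` (- Y) = {}" using sub q' AA' t by blast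
  ultimately show ?thesis by blast
qed

text \<open>Tits' commutator trick: \<open>x\<close> is the product of the disjointly supported conjugates
  \<open>t\<^sup>i a t\<^sup>-\<^sup>i\<close> for \<open>i \<ge> 0\<close>, so that \<open>a = x t x\<^sup>-\<^sup>1 t\<^sup>-\<^sup>1\<close>.\<close>

lemma K_subset_normal:
  assumes N: "N \<lhd> Gm" and t: "t \<in> N"
    and X: "t ` X \<subseteq> X" "half p q \<subseteq> X" "half p q \<inter> t ` X = {}"
  shows "K p q \<subseteq> N"
proof
  fix a assume a: "a \<in> K p q"
  note NJ = subgroup_GmD[OF normal_GmD(1)[OF N]]
  have tG: "t \<in> G" using t NJ by blast
  define T where "T i = t ^^ i" for i
  have TG: "T i \<in> G" for i
  proof (induction i)
    case 0
    then show ?case using id_G by (simp add: T_def id_def)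
  next
    case (Suc i)
    then show ?case using comp_G[OF tG] by (simp only: T_def funpow.simps)
  qed
  have TX: "T i w \<in> X" if "w \<in> half p q" for i w
    using that X by (induction i) (auto simp: T_def)
  have T_Suc: "T (Suc i) w = t (T i w)" for i w by (simp add: T_def)
  have "\<exists>f. loc (T i) p f" for i by (meson G_E TG)
  then obtain f where f: "\<And>i. loc (T i) p (f i)" by metis
  define H where "H i = half (T i p) (f i q)" for i
  have H: "T i w \<in> H i \<longleftrightarrow> w \<in> half p q" for i w
    unfolding H_def using U_half_iff[OF G_U[OF TG] f] .
  have H_E: "\<exists>w0. w = T i w0 \<and> w0 \<in> half p q" if "w \<in> H i" for w i
    using that H[of i "inv (T i) w"] apply_inv[OF TG[of i], of w] by metis
  have H_shift: "t w \<in> H (Suc i) \<longleftrightarrow> w \<in> H i" for w i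
    using H[of i "inv (T i) w"] H[of "Suc i" "inv (T i) w"] TG by (simp add: T_Suc)
  have "f 0 = id" using f[of 0] loc_id loc_unique by (metis T_def funpow_0 id_apply eq_id_iff loc_def)
  then have H0: "H 0 = half p q" by (simp add: H_def T_def)
  have disj': "H i \<inter> H (i + Suc k) = {}" for i k
  proof -
    have False if w: "w \<in> H i" "w \<in> H (i + Suc k)" for w
    proof -
      obtain w1 where w1: "w = T i w1" "w1 \<in> half p q" using H_E[OF w(1)] by blast
      obtain w2 where w2: "w = T (i + Suc k) w2" "w2 \<in> half p q" using H_E[OF w(2)] by blast
      have "T (i + Suc k) w2 = T i (T (Suc k) w2)" unfolding T_def by (simp only: funpow_add o_apply)
      then have "T i w1 = T i (T (Suc k) w2)" using w1 w2 by simp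
      then have "w1 = t (T k w2)" using inv_apply[OF TG[of i]] by (metis T_Suc)
      then show False using TX[OF w2(2), of k] w1(2) X(3) by blast
    qed
    then show ?thesis by blast
  qed
  have disj: "H i \<inter> H j = {}" if "i \<noteq> j" for i j
  proof (cases "i < j")
    case True
    then show ?thesis using disj' less_imp_Suc_add[of i j] by (metis add_Suc_right)
  next
    case False
    then show ?thesis using disj' less_imp_Suc_add[of j i] that
      by (metis add_Suc_right inf_commute linorder_neqE_nat)
  qed
  define b where "b i = T i \<circ> a \<circ> inv (T i)" for i
  have b: "b i \<in> K (T i p) (f i q)" for i unfolding b_def using K_conj[OF a TG f] .
  have b_shift: "b (Suc i) (t w) = t (b i w)" for i w
  proof -
    have "inv (T (Suc i)) (t w) = inv (T i) w"
      using inv_apply[OF TG[of "Suc i"], of "inv (T i) w"] TG by (simp add: T_Suc)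
    then show ?thesis by (simp add: b_def T_Suc)
  qed
  define x where "x w = (if \<exists>i. w \<in> H i then b (THE i. w \<in> H i) w else w)" for w
  have x: "x w = b i w" if "w \<in> H i" for w i
  proof -
    have "(THE i. w \<in> H i) = i" using that disj by blast
    then show ?thesis using that by (auto simp: x_def)
  qed
  have x': "x w = w" if "\<And>i. w \<notin> H i" for w using that by (simp add: x_def)
  have xG: "x \<in> G"
    by (rule paste_G[of b "\<lambda>i. T i p" "\<lambda>i. f i q"]) (use b disj x x' in \<open>auto simp: H_def\<close>)
  have a_fix: "a w = w" if "w \<notin> H 0" for w using a that by (simp add: H0 K_def)
  \<comment> \<open>Conjugation by \<open>t\<close> shifts the factors of \<open>x\<close> by one
    index and so loses exactly the factor with index 0, which is \<open>a\<close>.\<close>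
  have "x (t w) = a (t (x w))" for w
  proof (cases "\<exists>i. w \<in> H i")
    case True
    then obtain i where i: "w \<in> H i" by blast
    have "x (t w) = t (x w)" using x[OF i] x[of "t w" "Suc i"] i H_shift b_shift by simp
    moreover have "x w \<in> H i" using x[OF i] K_half[OF b] i by (simp add: H_def)
    then have "t (x w) \<notin> H 0" using H_shift disj[of 0 "Suc i"] by blast
    ultimately show ?thesis using a_fix by simp
  next
    case False
    show ?thesis
    proof (cases "t w \<in> H 0")
      case True
      then show ?thesis using x[OF True] x'[of w] False by (simp add: b_def T_def)
    next
      case tw: False
      have "t w \<notin> H i" for i using tw False H_shift by (cases i) auto
      then show ?thesis using x' a_fix False tw by simp
    qed
  qed
  from this[of "inv x (inv t _)"] have "a = (x \<circ> t \<circ> inv x) \<circ> inv t"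
    using xG tG by (simp add: fun_eq_iff)
  moreover have "x \<circ> t \<circ> inv x \<in> N" using normal_GmD(2)[OF N xG t] .
  ultimately show "a \<in> N" using NJ t by blast
qed

text \<open>Conjugation in \<open>G\<close> preserves the parity of the root of a half-tree. Passing
  to a half-tree rooted at the tip supplies the other parity.\<close>

lemma half_contains_other_parity: "\<exists>r s. half r s \<subseteq> half p q \<and> (par r \<longleftrightarrow> \<not> par p)"
proof -
  obtain s where s: "s \<notin> {q}" using ex_new_if_finite[of "{q}"] by auto
  have "p \<in> half (nb p q) q" using tip_half[of "nb p q" q] by simp
  then have "p \<notin> half (nb p q) s" using s half_unique by blast
  then have "half (nb p q) s \<subseteq> half p q" by (intro half_mono) auto
  then show ?thesis by (metis par_nb)
qed

text \<open>A nontrivial \<open>N\<close> contains all rigid stabilisers of half-trees. The fixator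
  of an edge is the product of those on its two sides, and the fixators of edges at \<open>u\<close>
  realise the point stabilisers of \<open>F\<close>, which generate \<open>F\<close>; so
  \<open>N\<close> contains all vertex stabilisers.\<close>

lemma normal_trivial_or_all:
  assumes N: "N \<lhd> Gm"
  shows "N = {id} \<or> N = G"
proof (cases "N = {id}")
  case False
  note NJ = subgroup_GmD[OF normal_GmD(1)[OF N]]
  obtain n where "n \<in> N" "n \<noteq> id" using False NJ(2) by blast
  then obtain t X p q where "t \<in> N" "t ` X \<subseteq> X" "half p q \<subseteq> X" "half p q \<inter> t ` X = {}"
    using normal_translation[OF N] by metis
  then have Kpq: "K p q \<subseteq> N" using K_subset_normal[OF N] by metis
  obtain r s where rs: "half r s \<subseteq> half p q" "par r \<longleftrightarrow> \<not> par p" using half_contains_other_parity by blast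
  have "K r s \<subseteq> K p q" using rs(1) by (auto simp: K_def)
  then have K: "K u e \<subseteq> N" for u e
    using K_subset_normal_transport[OF N, of p q u e] K_subset_normal_transport[OF N, of r s u e]
      Kpq rs(2) by blast
  have edge: "g \<in> N" if g: "g \<in> G" "g u = u" "g (nb u d) = nb u d" for g u d
  proof -
    define x where "x = (\<lambda>w. if w \<in> half u d then g w else w)"
    define y where "y = (\<lambda>w. if w \<in> half (nb u d) d then g w else w)"
    have "x \<in> N" using cut_G[OF g] K by (auto simp: x_def)
    moreover have "y \<in> N" using cut_G[of g "nb u d" d] g K by (auto simp: y_def)
    moreover have "g w \<in> half u d \<longleftrightarrow> w \<in> half u d" for w
    proof -
      obtain f where f: "loc g u f" using g(1) by (rule G_E)
      then have "f d = d" using g loc_nb[of g u f d] by simp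
      then show ?thesis using U_half_iff[OF G_U[OF g(1)] f, of w d] g(2) by simp
    qed
    then have "x \<circ> y = g" by (auto simp: x_def y_def fun_eq_iff half_opposite)
    ultimately show ?thesis using NJ(3) by metis
  qed
  have "g \<in> N" if "g \<in> G" "g u = u" for g u
  proof (rule vertex_stabiliser_subset[OF normal_GmD(1)[OF N], of "{f \<in> F. \<exists>d. f d = d}"])
    show "J' = F" if "perm_group J'" "J' \<subseteq> F" "{f \<in> F. \<exists>d. f d = d} \<subseteq> J'" for J'
      using gen_stab[OF that(1,2)] that(3) by blast
    show "h \<in> N" if "f \<in> {f \<in> F. \<exists>d. f d = d}" "h \<in> G" "h u = u" "loc h u f" for f h
      using that edge[of h u] loc_nb[OF that(4)] by force
    show "h \<in> N" if "h \<in> G" "h u = u" "loc h u id" for h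
      using that edge[of h u 0] loc_nb[OF that(3)] by force
  qed (use that in auto)
  then have "N = G" by (rule eq_G_if_stabilisers[OF normal_GmD(1)[OF N]])
  then show ?thesis ..
qed simp

text \<open>A nontrivial element of the stabiliser of \<open>d\<close> in \<open>F\<close> is
  realised around the tip \<open>nb v d\<close> and then cut along the edge back to
  \<open>v\<close>.\<close>

lemma K_nontrivial: "\<exists>g\<in>K v d. g \<noteq> id"
proof -
  define u where "u = nb v d"
  obtain f where f: "f \<in> F" "f d = d" "f \<noteq> id" using nontrivial_stab by blast
  obtain g where g: "g \<in> G" "g u = u" "loc g u f"
    using ex_G_constant_local[OF f(1), of u u] by auto
  have "g v = v" using loc_nb[OF g(3), of d] f(2) g(2) by (simp add: u_def)
  define x where "x = (\<lambda>w. if w \<in> half v d then g w else w)"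
  have "x \<in> K v d" unfolding x_def using g \<open>g v = v\<close> by (intro cut_G) (auto simp: u_def)
  moreover obtain c where c: "f c \<noteq> c" using f(3) by (auto simp: fun_eq_iff)
  have "nb u c \<in> half v d" using half_nb[of u v d c] c f(2) by (auto simp: u_def)
  then have "x (nb u c) = nb u (f c)" using loc_nb[OF g(3)] g(2) by (simp add: x_def)
  then have "x \<noteq> id" using c by auto
  ultimately show ?thesis by blast
qed

text \<open>A finite set meets only finitely many of the infinitely many half-trees at
  \<open>origin\<close>; the rigid stabiliser of a missed one fixes the set. This gives
  non-discreteness and, for the empty set, that \<open>G\<close> is nontrivial.\<close>

lemma fixator_nontrivial:
  assumes "finite B"
  shows "\<exists>g\<in>G. g \<noteq> id \<and> (\<forall>b\<in>B. g b = b)"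
proof -
  define D where "D = {d. \<exists>b\<in>B. b \<in> half origin d}"
  have "D \<subseteq> (\<lambda>b. THE d. b \<in> half origin d) ` B"
  proof
    fix d assume "d \<in> D"
    then obtain b where b: "b \<in> B" "b \<in> half origin d" by (auto simp: D_def)
    then have "(THE d. b \<in> half origin d) = d" using half_unique by blast
    then show "d \<in> (\<lambda>b. THE d. b \<in> half origin d) ` B" using b by blast
  qed
  then have "finite D" using assms finite_surj by blast
  then obtain d where "d \<notin> D" using ex_new_if_finite infinite_UNIV_nat by blast
  then have "\<forall>b\<in>B. b \<notin> half origin d" by (auto simp: D_def)
  moreover obtain g where "g \<in> K origin d" "g \<noteq> id" using K_nontrivial by blast
  ultimately show ?thesis by (auto simp: K_def)
qed

lemma simple_Gm: "abstractly_simple Gm"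
  unfolding abstractly_simple_def using normal_trivial_or_all fixator_nontrivial[of "{}"] by auto

end

section \<open>The topology of pointwise convergence\<close>

abbreviation pointwise :: "(vert \<Rightarrow> vert) topology" where
  "pointwise \<equiv> product_topology (\<lambda>_. discrete_topology UNIV) UNIV"

lemma topspace_pointwise: "topspace pointwise = UNIV"
  by (simp add: PiE_def extensional_def)

lemma openin_pointwise:
  "openin pointwise W \<longleftrightarrow> (\<forall>g\<in>W. \<exists>B. finite B \<and> (\<forall>h. (\<forall>b\<in>B. h b = g b) \<longrightarrow> h \<in> W))"
    (is "_ \<longleftrightarrow> ?R")
proof
  assume "openin pointwise W"
  then have op: "\<And>g. g \<in> W \<Longrightarrow> \<exists>V. finite {i. V i \<noteq> UNIV} \<and> g \<in> Pi\<^sub>E UNIV V \<and> Pi\<^sub>E UNIV V \<subseteq> W"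
    unfolding openin_product_topology_alt by simp
  show ?R
  proof
    fix g assume "g \<in> W"
    from op[OF this] obtain V
      where V: "finite {i. V i \<noteq> UNIV}" "g \<in> Pi\<^sub>E UNIV V" "Pi\<^sub>E UNIV V \<subseteq> W" by blast
    have "h \<in> W" if "\<forall>b\<in>{i. V i \<noteq> UNIV}. h b = g b" for h
    proof -
      have "h i \<in> V i" for i using that V(2) by (cases "V i = UNIV") auto
      then show ?thesis using V(3) by auto
    qed
    then show "\<exists>B. finite B \<and> (\<forall>h. (\<forall>b\<in>B. h b = g b) \<longrightarrow> h \<in> W)" using V(1) by blast
  qed
next
  assume R: ?R
  show "openin pointwise W"
    unfolding openin_product_topology_alt
  proof
    fix g assume "g \<in> W"
    with R obtain B where B: "finite B" "\<And>h. (\<forall>b\<in>B. h b = g b) \<Longrightarrow> h \<in> W" by blast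
    define V where "V i = (if i \<in> B then {g i} else UNIV)" for i
    have "finite {i. V i \<noteq> UNIV}"
      by (rule finite_subset[OF _ B(1)]) (auto simp: V_def)
    moreover have "g \<in> Pi\<^sub>E UNIV V" by (auto simp: V_def)
    moreover have "Pi\<^sub>E UNIV V \<subseteq> W"
    proof
      fix h assume "h \<in> Pi\<^sub>E UNIV V"
      then have "h i \<in> V i" for i by auto
      then show "h \<in> W" by (intro B(2)) (metis V_def singletonD)
    qed
    ultimately show "\<exists>V. finite {i \<in> UNIV. V i \<noteq> topspace (discrete_topology UNIV)} \<and>
        (\<forall>i\<in>UNIV. openin (discrete_topology UNIV) (V i)) \<and> g \<in> Pi\<^sub>E UNIV V \<and> Pi\<^sub>E UNIV V \<subseteq> W"
      by (intro exI[of _ V]) simp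
  qed
qed

context tree_group
begin

definition T :: "(vert \<Rightarrow> vert) topology" where
  "T = subtopology pointwise G"

lemma topspace_T [simp]: "topspace T = G"
  by (simp add: T_def topspace_pointwise)

lemma openin_T:
  "openin T W \<longleftrightarrow>
     W \<subseteq> G \<and> (\<forall>g\<in>W. \<exists>B. finite B \<and> (\<forall>h\<in>G. (\<forall>b\<in>B. h b = g b) \<longrightarrow> h \<in> W))"
    (is "_ \<longleftrightarrow> ?R")
proof
  assume "openin T W"
  then obtain V where V: "openin pointwise V" "W = V \<inter> G"
    by (auto simp: T_def openin_subtopology)
  show ?R
  proof (intro conjI ballI)
    show "W \<subseteq> G" using V by blast
    fix g assume "g \<in> W"
    then obtain B where "finite B" "\<And>h. (\<forall>b\<in>B. h b = g b) \<Longrightarrow> h \<in> V"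
      using V unfolding openin_pointwise by blast
    then show "\<exists>B. finite B \<and> (\<forall>h\<in>G. (\<forall>b\<in>B. h b = g b) \<longrightarrow> h \<in> W)" using V(2) by blast
  qed
next
  assume R: ?R
  \<comment> \<open>The union of all cylinders whose trace on \<open>G\<close> lies in
    \<open>W\<close>, taken in the space of all maps.\<close>
  define V where "V = {h. \<exists>g\<in>W. \<exists>B. finite B \<and> (\<forall>h\<in>G. (\<forall>b\<in>B. h b = g b) \<longrightarrow> h \<in> W)
    \<and> (\<forall>b\<in>B. h b = g b)}"
  have "openin pointwise V"
    unfolding openin_pointwise
  proof
    fix h assume "h \<in> V"
    then obtain g B where *: "g \<in> W" "finite B" "\<forall>h\<in>G. (\<forall>b\<in>B. h b = g b) \<longrightarrow> h \<in> W"
      "\<forall>b\<in>B. h b = g b" by (auto simp: V_def)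
    have "k \<in> V" if "\<forall>b\<in>B. k b = h b" for k
      using * that unfolding V_def by auto
    then show "\<exists>B. finite B \<and> (\<forall>k. (\<forall>b\<in>B. k b = h b) \<longrightarrow> k \<in> V)" using *(2) by blast
  qed
  moreover have "W = V \<inter> G" using R unfolding V_def by blast
  ultimately show "openin T W" by (auto simp: T_def openin_subtopology)
qed

lemma openin_TE:
  assumes "openin T W" "g \<in> W"
  obtains B where "finite B" "\<And>h. h \<in> G \<Longrightarrow> (\<And>b. b \<in> B \<Longrightarrow> h b = g b) \<Longrightarrow> h \<in> W"
  using assms unfolding openin_T by (metis (no_types, lifting))

lemma openin_cylinder: "finite B \<Longrightarrow> openin T {h \<in> G. \<forall>b\<in>B. h b = g b}"
  unfolding openin_T by force

lemma continuous_mult: "continuous_map (prod_topology T T) T (\<lambda>(x, y). x \<circ> y)"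
  unfolding continuous_map_def
proof (intro conjI allI impI)
  show "(\<lambda>(x, y). x \<circ> y) \<in> topspace (prod_topology T T) \<rightarrow> topspace T"
    by (auto intro: comp_G)
  fix W assume W: "openin T W"
  show "openin (prod_topology T T) {z \<in> topspace (prod_topology T T). (case z of (x, y) \<Rightarrow> x \<circ> y) \<in> W}"
    unfolding openin_prod_topology_alt
  proof (intro allI impI)
    fix g h assume "(g, h) \<in> {z \<in> topspace (prod_topology T T). (case z of (x, y) \<Rightarrow> x \<circ> y) \<in> W}"
    then have gh: "g \<in> G" "h \<in> G" "g \<circ> h \<in> W" by auto
    from openin_TE[OF W this(3)] obtain B
      where B: "finite B" "\<And>k. k \<in> G \<Longrightarrow> (\<And>b. b \<in> B \<Longrightarrow> k b = (g \<circ> h) b) \<Longrightarrow> k \<in> W" by blast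
    let ?V = "{k \<in> G. \<forall>b\<in>h ` B. k b = g b}" and ?V' = "{k \<in> G. \<forall>b\<in>B. k b = h b}"
    have "openin T ?V" "openin T ?V'"
      by (rule openin_cylinder, use B(1) in simp)+
    moreover have "?V \<times> ?V' \<subseteq> {z \<in> topspace (prod_topology T T). (case z of (x, y) \<Rightarrow> x \<circ> y) \<in> W}"
      using B(2) comp_G by auto
    ultimately show "\<exists>V V'. openin T V \<and> openin T V' \<and> g \<in> V \<and> h \<in> V' \<and>
        V \<times> V' \<subseteq> {z \<in> topspace (prod_topology T T). (case z of (x, y) \<Rightarrow> x \<circ> y) \<in> W}"
      using gh by (intro exI[of _ ?V] exI[of _ ?V']) auto
  qed
qed

lemma continuous_left_mult:
  assumes g: "g \<in> G"
  shows "continuous_map T T (\<lambda>h. g \<circ> h)"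
  unfolding continuous_map_def
proof (intro conjI allI impI)
  show "(\<lambda>h. g \<circ> h) \<in> topspace T \<rightarrow> topspace T" using g by (auto intro: comp_G)
  fix W assume W: "openin T W"
  show "openin T {h \<in> topspace T. g \<circ> h \<in> W}"
    unfolding openin_T
  proof (intro conjI ballI)
    fix h assume "h \<in> {h \<in> topspace T. g \<circ> h \<in> W}"
    then have "g \<circ> h \<in> W" by simp
    from openin_TE[OF W this] obtain B
      where B: "finite B" "\<And>k. k \<in> G \<Longrightarrow> (\<And>b. b \<in> B \<Longrightarrow> k b = (g \<circ> h) b) \<Longrightarrow> k \<in> W" by blast
    have "\<forall>k\<in>G. (\<forall>b\<in>B. k b = h b) \<longrightarrow> k \<in> {h \<in> topspace T. g \<circ> h \<in> W}"
      using B(2) comp_G[OF g] by simp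
    then show "\<exists>B. finite B \<and> (\<forall>k\<in>G. (\<forall>b\<in>B. k b = h b) \<longrightarrow> k \<in> {h \<in> topspace T. g \<circ> h \<in> W})"
      using B(1) by blast
  qed auto
qed

lemma continuous_inv: "continuous_map T T inv"
  unfolding continuous_map_def
proof (intro conjI allI impI)
  show "inv \<in> topspace T \<rightarrow> topspace T" by (auto intro: inv_G)
  fix W assume W: "openin T W"
  show "openin T {g \<in> topspace T. inv g \<in> W}"
    unfolding openin_T
  proof (intro conjI ballI)
    fix g assume g: "g \<in> {g \<in> topspace T. inv g \<in> W}"
    then have "inv g \<in> W" by simp
    from openin_TE[OF W this] obtain B
      where B: "finite B" "\<And>k. k \<in> G \<Longrightarrow> (\<And>b. b \<in> B \<Longrightarrow> k b = inv g b) \<Longrightarrow> k \<in> W" by blast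
    have "inv k \<in> W" if k: "k \<in> G" "\<forall>b\<in>inv g ` B. k b = g b" for k
    proof (rule B(2))
      show "inv k \<in> G" using k inv_G by blast
      show "inv k b = inv g b" if "b \<in> B" for b
      proof -
        have "k (inv g b) = b" using k that g by simp
        then show ?thesis using inv_apply[OF k(1)] by metis
      qed
    qed
    then have "\<forall>k\<in>G. (\<forall>b\<in>inv g ` B. k b = g b) \<longrightarrow> k \<in> {g \<in> topspace T. inv g \<in> W}" by simp
    then show "\<exists>B. finite B \<and> (\<forall>k\<in>G. (\<forall>b\<in>B. k b = g b) \<longrightarrow> k \<in> {g \<in> topspace T. inv g \<in> W})"
      using B(1) finite_imageI by blast
  qed auto
qed

lemma topological_group_Gm: "topological_group Gm T"
proof -
  have "continuous_map T T (\<lambda>x. m_inv Gm x)"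
    using continuous_map_eq[OF continuous_inv, of "\<lambda>x. m_inv Gm x"] by (simp add: inv_Gm)
  then show ?thesis
    using group_Gm continuous_mult by (simp add: topological_group_def)
qed

lemma totally_disconnected_T: "totally_disconnected_space T"
  unfolding totally_disconnected_space_def
proof
  fix x assume x: "x \<in> topspace T"
  have "y = x" if "connected_component_of T x y" for y
  proof (rule ccontr)
    assume "y \<noteq> x"
    then obtain v where v: "y v \<noteq> x v" by blast
    obtain S where S: "connectedin T S" "x \<in> S" "y \<in> S"
      using \<open>connected_component_of T x y\<close> by (auto simp: connected_component_of_def)
    define V where "V = {h \<in> G. \<forall>b\<in>{v}. h b = x b}"
    have "openin T V" unfolding V_def by (rule openin_cylinder) simp
    moreover have "openin T (G - V)" unfolding openin_T
    proof (intro conjI ballI)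
      fix g assume "g \<in> G - V"
      then have "\<forall>h\<in>G. (\<forall>b\<in>{v}. h b = g b) \<longrightarrow> h \<in> G - V" by (auto simp: V_def)
      then show "\<exists>B. finite B \<and> (\<forall>h\<in>G. (\<forall>b\<in>B. h b = g b) \<longrightarrow> h \<in> G - V)"
        by (intro exI[of _ "{v}"]) auto
    qed auto
    then have "closedin T V" by (auto simp: closedin_def V_def)
    ultimately have "S \<subseteq> V \<or> disjnt S V" using connectedin_clopen_cases[OF S(1)] by blast
    then show False using S x v by (auto simp: V_def disjnt_iff)
  qed
  then show "connected_component_of_set T x = {x}"
    using x connected_component_of_refl by fastforce
qed

lemma not_discrete_T: "T \<noteq> discrete_topology (carrier Gm)"
proof
  assume "T = discrete_topology (carrier Gm)"
  then have "openin T {id}" using id_G by simp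
  then obtain B where B: "finite B" "\<And>h. h \<in> G \<Longrightarrow> (\<forall>b\<in>B. h b = id b) \<Longrightarrow> h = id"
    unfolding openin_T by auto
  show False using fixator_nontrivial[OF B(1)] B(2) by auto
qed

section \<open>Compact open subgroups\<close>

lemma finite_transporter: "finite {f \<in> F. f x = y}"
proof (cases "\<exists>f1\<in>F. f1 x = y")
  case True
  then obtain f1 where f1: "f1 \<in> F" "f1 x = y" by blast
  have "{f \<in> F. f x = y} \<subseteq> (\<lambda>k. f1 \<circ> k) ` {f \<in> F. f x = x}"
  proof
    fix f assume "f \<in> {f \<in> F. f x = y}"
    then have f: "f \<in> F" "f x = y" by auto
    have "inv f1 \<circ> f \<in> F" using comp_F inv_F f f1 by blast
    moreover have "(inv f1 \<circ> f) x = x" 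
      using f f1 bij_F[OF f1(1)] by (metis bij_inv_eq_iff comp_apply)
    moreover have "f = f1 \<circ> (inv f1 \<circ> f)"
      using bij_F[OF f1(1)] by (simp add: fun_eq_iff bij_is_surj surj_f_inv_f)
    ultimately show "f \<in> (\<lambda>k. f1 \<circ> k) ` {f \<in> F. f x = x}" by blast
  qed
  then show ?thesis using finite_stab finite_surj by blast
next
  case False
  then have "{f \<in> F. f x = y} = {}" by blast
  then show ?thesis by (simp only: finite.emptyI)
qed

lemma finite_transporter_nb: "finite {f \<in> F. nb x (f c) = y}"
proof (cases "\<exists>e. y = nb x e")
  case True
  then obtain e where "y = nb x e" by blast
  then have "{f \<in> F. nb x (f c) = y} = {f \<in> F. f c = e}" by auto
  then show ?thesis using finite_transporter by simp
next
  case False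
  then have "{f \<in> F. nb x (f c) = y} = {}" by blast
  then show ?thesis by (simp only: finite.emptyI)
qed

definition C :: "vert \<Rightarrow> nat \<Rightarrow> (vert \<Rightarrow> vert) set" where
  "C v d = {g \<in> G. g v = v \<and> g (nb v d) = nb v d}"

text \<open>The images of \<open>w\<close> and of one neighbour confine the local action at
  \<open>w\<close> to a transporter, which is finite as a coset of a point stabiliser. The image of
  any other neighbour then has finitely many values.\<close>

lemma finite_edge_orbit_step:
  assumes S: "S \<subseteq> G" and fin: "finite ((\<lambda>g. (g w, g (nb w c))) ` S)"
  shows "finite ((\<lambda>g. (g w, g (nb w c'))) ` S)"
proof -
  have "(\<lambda>g. (g w, g (nb w c'))) ` S \<subseteq>
    (\<Union>(x, y)\<in>(\<lambda>g. (g w, g (nb w c))) ` S. (\<lambda>f. (x, nb x (f c'))) ` {f \<in> F. nb x (f c) = y})"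
  proof
    fix z assume "z \<in> (\<lambda>g. (g w, g (nb w c'))) ` S"
    then obtain g where g: "g \<in> S" "z = (g w, g (nb w c'))" by blast
    obtain f where f: "f \<in> F" "loc g w f" using g S by (meson G_E subsetD)
    show "z \<in> (\<Union>(x, y)\<in>(\<lambda>g. (g w, g (nb w c))) ` S. (\<lambda>f. (x, nb x (f c'))) ` {f \<in> F. nb x (f c) = y})"
      using g f loc_nb[OF f(2)] by (intro UN_I[of "(g w, g (nb w c))"]) auto
  qed
  moreover have "finite (\<Union>(x, y)\<in>(\<lambda>g. (g w, g (nb w c))) ` S.
      (\<lambda>f. (x, nb x (f c'))) ` {f \<in> F. nb x (f c) = y})"
    using fin finite_transporter_nb by (intro finite_UN_I) auto
  ultimately show ?thesis by (rule finite_subset)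
qed

lemma finite_orbit_C: "finite ((\<lambda>g. g w) ` C v d)"
proof -
  have CG: "C v d \<subseteq> G" by (auto simp: C_def)
  have "\<forall>c. finite ((\<lambda>g. (g w, g (nb w c))) ` C v d)"
  proof (induction w rule: vert_induct_from[where u = v])
    case base
    have "(\<lambda>g. (g v, g (nb v d))) ` C v d \<subseteq> {(v, nb v d)}" by (auto simp: C_def)
    then show ?case using finite_edge_orbit_step[OF CG] finite_subset by blast
  next
    case (nb w e)
    have "(\<lambda>g. (g (nb w e), g (nb (nb w e) e))) ` C v d
        = prod.swap ` (\<lambda>g. (g w, g (nb w e))) ` C v d" by (auto simp: image_image)
    then have "finite ((\<lambda>g. (g (nb w e), g (nb (nb w e) e))) ` C v d)" using nb by simp
    then show ?case using finite_edge_orbit_step[OF CG] by blast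
  qed
  then have "finite (fst ` (\<lambda>g. (g w, g (nb w 0))) ` C v d)" by blast
  then show ?thesis by (simp add: image_image)
qed

text \<open>Only finitely many local actions at \<open>w\<close> send the edge of colour 0 as
  \<open>h\<close> does. If \<open>h\<close> had no local action in \<open>F\<close>, each of these
  candidates would fail at some colour, and an element agreeing with \<open>h\<close> at these
  finitely many places would have none left.\<close>

lemma C_limit:
  assumes lim: "\<And>B. finite B \<Longrightarrow> \<exists>g\<in>C v d. \<forall>b\<in>B. g b = h b"
  shows "h \<in> C v d"
proof -
  have "\<exists>f\<in>F. loc h w f" for w
  proof (rule ccontr)
    assume "\<not> (\<exists>f\<in>F. loc h w f)"
    then have "\<forall>f\<in>F. \<exists>c. h (nb w c) \<noteq> nb (h w) (f c)" by (auto simp: loc_def)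
    then obtain m where m: "\<And>f. f \<in> F \<Longrightarrow> h (nb w (m f)) \<noteq> nb (h w) (f (m f))" by metis
    define Q where "Q = {f \<in> F. nb (h w) (f 0) = h (nb w 0)}"
    define B where "B = {w, nb w 0} \<union> (\<lambda>f. nb w (m f)) ` Q"
    have "finite B" using finite_transporter_nb by (simp add: B_def Q_def)
    then obtain g where g: "g \<in> C v d" "\<forall>b\<in>B. g b = h b" using lim by blast
    then have "g \<in> G" by (simp add: C_def)
    then obtain f where f: "f \<in> F" "loc g w f" by (rule G_E)
    have gw: "g w = h w" "g (nb w 0) = h (nb w 0)" using g(2) by (auto simp: B_def)
    then have "f \<in> Q" using f loc_nb[OF f(2), of 0] by (simp add: Q_def)
    then have "g (nb w (m f)) = h (nb w (m f))" using g(2) by (simp add: B_def)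
    then show False using m[OF f(1)] loc_nb[OF f(2)] gw(1) by simp
  qed
  then have "h \<in> U" by (simp add: U_def)
  moreover have "h v = v \<and> h (nb v d) = nb v d"
    using lim[of "{v, nb v d}"] by (auto simp: C_def)
  ultimately show ?thesis using G_I[of h v] by (simp add: C_def)
qed

lemma compact_C: "compactin T (C v d)"
proof -
  have "closedin pointwise (C v d)"
    unfolding closedin_def
  proof
    show "C v d \<subseteq> topspace pointwise" by (simp only: topspace_pointwise subset_UNIV)
    have "openin pointwise (- C v d)"
      unfolding openin_pointwise using C_limit[of v d] by (metis ComplD ComplI)
    then show "openin pointwise (topspace pointwise - C v d)"
      by (simp only: topspace_pointwise Compl_eq_Diff_UNIV)
  qed
  moreover have "compactin pointwise (Pi\<^sub>E UNIV (\<lambda>w. (\<lambda>g. g w) ` C v d))"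
    unfolding compactin_PiE using finite_orbit_C by (simp add: compactin_discrete_topology)
  moreover have "C v d \<subseteq> Pi\<^sub>E UNIV (\<lambda>w. (\<lambda>g. g w) ` C v d)" by auto
  ultimately have "compactin pointwise (C v d)" by (meson closed_compactin)
  then show ?thesis by (auto simp: T_def compactin_subtopology C_def)
qed

lemma locally_compact_T: "locally_compact_space T"
  unfolding locally_compact_space_def
proof
  fix g assume "g \<in> topspace T"
  then have g: "g \<in> G" by simp
  let ?V = "{h \<in> G. \<forall>b\<in>{origin, nb origin 0}. h b = g b}"
  have "openin T ?V" by (rule openin_cylinder) simp
  moreover have "compactin T ((\<lambda>h. g \<circ> h) ` C origin 0)"
    by (rule image_compactin[OF compact_C continuous_left_mult[OF g]])
  moreover have "?V \<subseteq> (\<lambda>h. g \<circ> h) ` C origin 0"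
  proof
    fix h assume h: "h \<in> ?V"
    have "inv g \<circ> h \<in> C origin 0" using h g by (simp add: C_def comp_G inv_G)
    moreover have "h = g \<circ> (inv g \<circ> h)" using g by (simp add: fun_eq_iff)
    ultimately show "h \<in> (\<lambda>h. g \<circ> h) ` C origin 0" by blast
  qed
  ultimately show "\<exists>V Q. openin T V \<and> compactin T Q \<and> g \<in> V \<and> V \<subseteq> Q"
    using g by blast
qed

text \<open>The fixator of an edge contains the kernel of the local action at both of its ends.
  Adding finitely many lifts of generators of \<open>F\<close> at each end therefore yields both
  vertex stabilisers, and these generate \<open>G\<close>.\<close>

lemma compactly_generated_Gm: "compactly_generated_group Gm T"
proof -
  obtain A where A: "finite A" "A \<subseteq> F" "\<And>J. perm_group J \<Longrightarrow> J \<subseteq> F \<Longrightarrow> A \<subseteq> J \<Longrightarrow> J = F"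
    using finitely_generated by blast
  have "\<forall>u. \<forall>f\<in>F. \<exists>g\<in>G. g u = u \<and> loc g u f" using ex_G_constant_local by blast
  then obtain l where l: "\<And>u f. f \<in> F \<Longrightarrow> l u f \<in> G \<and> l u f u = u \<and> loc (l u f) u f" by metis
  define Q where "Q = C origin 0 \<union> (l origin ` A \<union> l (nb origin 0) ` A)"
  have QG: "Q \<subseteq> G" using l A(2) by (auto simp: Q_def C_def)
  have "finite (l origin ` A \<union> l (nb origin 0) ` A)" using A(1) by simp
  then have "compactin T (l origin ` A \<union> l (nb origin 0) ` A)"
    using QG by (intro finite_imp_compactin) (auto simp: Q_def)
  then have "compactin T Q" unfolding Q_def using compactin_Un[OF compact_C] by blast
  moreover have "generate Gm Q = G"
  proof -
    have J: "subgroup (generate Gm Q) Gm"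
      using group.generate_is_subgroup[OF group_Gm] QG by simp
    note JD = subgroup_GmD[OF J]
    have QJ: "g \<in> generate Gm Q" if "g \<in> Q" for g using that by (rule generate.incl)
    have stab: "g \<in> generate Gm Q" if u: "u = origin \<or> u = nb origin 0" and g: "g \<in> G" "g u = u" for u g
    proof -
      have id: "h \<in> generate Gm Q" if h: "h \<in> G" "h u = u" "loc h u id" for h
      proof -
        have "h (nb u 0) = nb u 0" using loc_nb[OF h(3)] h(2) by simp
        then have "h \<in> C origin 0" using u h by (auto simp: C_def)
        then show ?thesis using QJ by (simp add: Q_def)
      qed
      have gen: "h \<in> generate Gm Q" if f: "f \<in> A" and h: "h \<in> G" "h u = u" "loc h u f" for f h
      proof -
        have fF: "f \<in> F" using f A by blast
        note k = l[OF fF, of u]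
        have kJ: "l u f \<in> generate Gm Q" using u f QJ by (auto simp: Q_def)
        have "loc (inv (l u f)) u (inv f)" using loc_inv_G[of "l u f" u f] k by simp
        then have "loc (inv (l u f) \<circ> h) u (inv f \<circ> f)" using loc_comp[OF h(3)] h(2) by simp
        moreover have "inv f \<circ> f = id" using bij_F[OF fF] by (simp add: bij_is_inj)
        moreover have "inv (l u f) u = u" using k inv_apply by metis
        ultimately have "inv (l u f) \<circ> h \<in> generate Gm Q"
          using id k h by (simp add: comp_G inv_G)
        from JD(3)[OF kJ this] have "l u f \<circ> (inv (l u f) \<circ> h) \<in> generate Gm Q" .
        moreover have "l u f \<circ> (inv (l u f) \<circ> h) = h" using k by (simp add: fun_eq_iff)
        ultimately show ?thesis by simp
      qed
      show ?thesis by (rule vertex_stabiliser_subset[OF J A(3,2) gen id g])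
    qed
    show ?thesis by (rule eq_G_if_edge_stabilisers[OF J, of 0]) (use stab in auto)
  qed
  ultimately show ?thesis using QG by (auto simp: compactly_generated_group_def)
qed

text \<open>The fixator of the unit ball at \<open>origin\<close>, modulo which the stabiliser of
  \<open>origin\<close> is \<open>F\<close>.\<close>

definition ker :: "(vert \<Rightarrow> vert) set" where
  "ker = {g \<in> G. g origin = origin \<and> loc g origin id}"

text \<open>The unit ball is infinite, yet finitely many vertices detect its fixator: the stabiliser
  of colour 0 in \<open>F\<close> is finite, and one moved colour excludes each of its nontrivial
  elements.\<close>

lemma openin_ker: "openin T ker"
  unfolding openin_T
proof (intro conjI ballI)
  fix g assume g: "g \<in> ker"
  define Q where "Q = {f \<in> F. f 0 = 0} - {id}"
  have "\<forall>f\<in>Q. \<exists>c. f c \<noteq> c" by (auto simp: Q_def fun_eq_iff)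
  then obtain m where m: "\<And>f. f \<in> Q \<Longrightarrow> f (m f) \<noteq> m f" by metis
  define B where "B = {origin, nb origin 0} \<union> (\<lambda>f. nb origin (m f)) ` Q"
  have "finite B" using finite_stab by (simp add: B_def Q_def)
  moreover have "h \<in> ker" if h: "h \<in> G" "\<forall>b\<in>B. h b = g b" for h
  proof -
    have gfix: "g origin = origin" "g (nb origin c) = nb origin c" for c
      using g by (auto simp: ker_def loc_def)
    obtain f where f: "f \<in> F" "loc h origin f" using h(1) by (rule G_E)
    have horigin: "h origin = origin" "h (nb origin 0) = nb origin 0" using h(2) gfix by (auto simp: B_def)
    then have "f 0 = 0" using loc_nb[OF f(2), of 0] by simp
    have "f = id"
    proof (rule ccontr)
      assume "f \<noteq> id"
      then have "f \<in> Q" using f \<open>f 0 = 0\<close> by (simp add: Q_def)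
      then have "h (nb origin (m f)) = nb origin (m f)" using h(2) gfix by (simp add: B_def)
      then show False using loc_nb[OF f(2), of "m f"] horigin m[OF \<open>f \<in> Q\<close>] by simp
    qed
    then show ?thesis using f h horigin by (simp add: ker_def)
  qed
  ultimately show "\<exists>B. finite B \<and> (\<forall>h\<in>G. (\<forall>b\<in>B. h b = g b) \<longrightarrow> h \<in> ker)" by blast
qed (auto simp: ker_def)

lemma compact_ker: "compactin T ker"
proof (rule closed_compactin[OF compact_C[of origin 0]])
  show "ker \<subseteq> C origin 0" by (auto simp: ker_def C_def loc_def)
  have "openin T (G - ker)"
    unfolding openin_T
  proof (intro conjI ballI)
    fix g assume g: "g \<in> G - ker"
    then obtain c where c: "g origin \<noteq> origin \<or> g (nb origin c) \<noteq> nb origin c"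
      by (auto simp: ker_def loc_def)
    have "h \<in> G - ker" if h: "h \<in> G" "\<forall>b\<in>{origin, nb origin c}. h b = g b" for h
    proof -
      have "h origin \<noteq> origin \<or> h (nb origin c) \<noteq> nb origin c" using h(2) c by simp
      then show ?thesis using h(1) by (auto simp: ker_def loc_def)
    qed
    then show "\<exists>B. finite B \<and> (\<forall>h\<in>G. (\<forall>b\<in>B. h b = g b) \<longrightarrow> h \<in> G - ker)"
      by (intro exI[of _ "{origin, nb origin c}"]) auto
  qed auto
  then show "closedin T ker" by (auto simp: closedin_def ker_def)
qed

end

section \<open>Uncountably many local actions\<close>

definition ev :: "(nat \<Rightarrow> 'o \<Rightarrow> 'o) \<Rightarrow> nat list \<Rightarrow> 'o \<Rightarrow> 'o" where
  "ev h w = foldr (\<lambda>i f. h i \<circ> f) w id"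

lemma ev_Nil [simp]: "ev h [] = id"
  and ev_Cons [simp]: "ev h (i # w) = h i \<circ> ev h w"
  by (simp_all add: ev_def)

lemma ev_append: "ev h (w @ w') = ev h w \<circ> ev h w'"
  by (induction w) (auto simp: comp_assoc)

lemma ev_hom:
  assumes "\<phi> id = id" "\<And>w i. \<phi> (h i \<circ> ev h w) = \<phi> (h i) \<circ> \<phi> (ev h w)"
  shows "\<phi> (ev h w) = ev (\<lambda>i. \<phi> (h i)) w"
  by (induction w) (simp_all only: ev_Nil ev_Cons assms)

text \<open>The braid relation makes every generator conjugate to the involution \<open>h 0\<close>, so the group acts
  on the cosets of the subgroup of order two generated by \<open>h 0\<close> and is generated by its point
  stabilisers.\<close>

locale braid_gens =
  fixes h :: "nat \<Rightarrow> 'o \<Rightarrow> 'o"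
  assumes invol: "h i \<circ> h i = id"
    and braid: "h i \<circ> (h 0 \<circ> h i) = (h 0 \<circ> h i) \<circ> h 0"
    and noncomm: "\<exists>i. h 0 \<circ> h i \<noteq> h i \<circ> h 0"
    and finite_gens: "finite (range h)"
    and infinite_ev: "infinite (range (ev h))"
begin

definition coset :: "('o \<Rightarrow> 'o) \<Rightarrow> ('o \<Rightarrow> 'o) set" where
  "coset f = {f, f \<circ> h 0}"

text \<open>Colours are natural numbers, so the countably infinite set of cosets is numbered before
  the group can act on it.\<close>

definition enum :: "nat \<Rightarrow> ('o \<Rightarrow> 'o) set" where
  "enum = (SOME e. bij_betw e UNIV (coset ` range (ev h)))"

definition act :: "('o \<Rightarrow> 'o) \<Rightarrow> nat \<Rightarrow> nat" where
  "act f n = inv enum ((\<lambda>x. f \<circ> x) ` enum n)"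

definition act_group :: "(nat \<Rightarrow> nat) set" where
  "act_group = act ` range (ev h)"

section \<open>The action on cosets of a subgroup of order two\<close>

lemma ev_rev: "ev h (rev w) \<circ> ev h w = id"
proof (induction w)
  case (Cons i w)
  have "ev h (rev (i # w)) \<circ> ev h (i # w) = ev h (rev w) \<circ> (h i \<circ> h i) \<circ> ev h w"
    by (simp add: ev_append comp_assoc)
  also have "\<dots> = id" by (simp only: invol comp_id Cons.IH)
  finally show ?case .
qed simp

lemma ev_rev': "ev h w \<circ> ev h (rev w) = id"
  using ev_rev[of "rev w"] by simp

lemma ev_eq_iff: "ev h w = ev h w' \<longleftrightarrow> ev h (rev w' @ w) = id"
proof
  assume "ev h (rev w' @ w) = id"
  then have "ev h w' \<circ> (ev h (rev w') \<circ> ev h w) = ev h w'" by (simp add: ev_append)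
  then show "ev h w = ev h w'" by (simp add: comp_assoc[symmetric] ev_rev')
qed (simp add: ev_append ev_rev)

lemma bij_enum: "bij_betw enum UNIV (coset ` range (ev h))"
proof -
  have cnt: "countable (coset ` range (ev h))" by (intro countable_image) simp
  have "infinite (coset ` range (ev h))"
  proof
    assume "finite (coset ` range (ev h))"
    then have "finite (\<Union> (coset ` range (ev h)))" by (rule finite_Union) (auto simp: coset_def)
    moreover have "range (ev h) \<subseteq> \<Union> (coset ` range (ev h))" by (auto simp: coset_def)
    ultimately show False using infinite_ev finite_subset by blast
  qed
  with cnt obtain e :: "nat \<Rightarrow> _" where "bij_betw e UNIV (coset ` range (ev h))"
    using bij_betw_from_nat_into by blast
  then show ?thesis
    unfolding enum_def by (rule someI[of "\<lambda>e. bij_betw e UNIV (coset ` range (ev h))"])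
qed

lemma inj_enum: "inj enum"
  using bij_enum by (rule bij_betw_imp_inj_on)

lemma enum_E: obtains w where "enum n = coset (ev h w)"
  using bij_enum by (metis (no_types, lifting) bij_betwE imageE rangeE UNIV_I)

lemma ex_enum: "\<exists>n. enum n = coset (ev h w)"
  using bij_enum by (metis bij_betw_imp_surj_on imageE image_eqI rangeI)

lemma mult_coset: "(\<lambda>x. f \<circ> x) ` coset g = coset (f \<circ> g)"
  by (auto simp: coset_def comp_assoc)

lemma enum_act: "enum (act (ev h w) n) = (\<lambda>x. ev h w \<circ> x) ` enum n"
proof -
  obtain w' where "enum n = coset (ev h w')" by (rule enum_E)
  then have "(\<lambda>x. ev h w \<circ> x) ` enum n = coset (ev h (w @ w'))" by (simp add: mult_coset ev_append)
  then have "(\<lambda>x. ev h w \<circ> x) ` enum n \<in> range enum" using ex_enum by (metis rangeI)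
  then show ?thesis by (simp add: act_def f_inv_into_f)
qed

lemma act_eq_iff:
  assumes "enum x = coset (ev h w')"
  shows "act (ev h w) x = y \<longleftrightarrow> enum y = coset (ev h w \<circ> ev h w')"
  using enum_act[of w x] inj_eq[OF inj_enum, of "act (ev h w) x" y] assms by (auto simp: mult_coset)

lemma act_comp: "act (ev h w \<circ> ev h w') = act (ev h w) \<circ> act (ev h w')"
proof
  fix n
  obtain u where u: "enum n = coset (ev h u)" by (rule enum_E)
  have "enum (act (ev h w') n) = coset (ev h (w' @ u))"
    using act_eq_iff[OF u, of w' "act (ev h w') n"] by (simp add: ev_append)
  then have "act (ev h w) (act (ev h w') n) = act (ev h (w @ w')) n"
    using act_eq_iff[of n u "w @ w'" "act (ev h (w @ w')) n"] u
      act_eq_iff[of "act (ev h w') n" "w' @ u" w "act (ev h (w @ w')) n"]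
    by (simp add: ev_append comp_assoc)
  then show "act (ev h w \<circ> ev h w') n = (act (ev h w) \<circ> act (ev h w')) n"
    by (simp add: ev_append)
qed

lemma act_id: "act id = id"
  by (simp add: act_def fun_eq_iff inj_enum)

lemma gen0_neq_id: "h 0 \<noteq> id"
  using noncomm by auto

text \<open>A coset has only two elements, so a nontrivial group element fixing every coset
  multiplies each \<open>ev h u\<close> on the left as \<open>h 0\<close> does on the right. The
  empty word identifies it with \<open>h 0\<close>, and the one-letter words then make
  \<open>h 0\<close> central, against \<open>noncomm\<close>.\<close>

lemma act_faithful:
  assumes "act (ev h w) = id"
  shows "ev h w = id"
proof (rule ccontr)
  assume neq: "ev h w \<noteq> id"
  have *: "ev h w \<circ> ev h u = ev h u \<circ> h 0" for u
  proof -
    obtain n where n: "enum n = coset (ev h u)" using ex_enum by blast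
    have "act (ev h w) n = n" using assms by simp
    then have "coset (ev h w \<circ> ev h u) = coset (ev h u)" using act_eq_iff[OF n, of w n] n by simp
    then have "ev h w \<circ> ev h u \<in> {ev h u, ev h u \<circ> h 0}" by (auto simp: coset_def)
    moreover have "ev h w \<circ> ev h u \<noteq> ev h u"
    proof
      assume "ev h w \<circ> ev h u = ev h u"
      then have "ev h w \<circ> (ev h u \<circ> ev h (rev u)) = ev h u \<circ> ev h (rev u)"
        by (simp add: comp_assoc[symmetric])
      then show False using neq by (simp add: ev_rev')
    qed
    ultimately show ?thesis by blast
  qed
  from *[of "[]"] have "ev h w = h 0" by simp
  then show False using *[of "[i]" for i] noncomm by auto
qed

lemma bij_act: "bij (act (ev h w))" and inv_act: "inv (act (ev h w)) = act (ev h (rev w))"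
proof -
  have 1: "act (ev h (rev w)) \<circ> act (ev h w) = id"
    using act_comp[of "rev w" w] by (simp add: ev_rev act_id)
  have 2: "act (ev h w) \<circ> act (ev h (rev w)) = id"
    using act_comp[of w "rev w"] by (simp add: ev_rev' act_id)
  show "bij (act (ev h w))" using 1 2 o_bij by blast
  show "inv (act (ev h w)) = act (ev h (rev w))" using 1 2 inv_unique_comp by blast
qed

lemma perm_group_act: "perm_group act_group"
proof
  show "id \<in> act_group" unfolding act_group_def using act_id ev_Nil by (metis imageI rangeI)
  fix f assume "f \<in> act_group"
  then obtain w where w: "f = act (ev h w)" by (auto simp: act_group_def)
  show "bij f" using w bij_act by simp
  show "inv f \<in> act_group" using w inv_act by (auto simp: act_group_def)
  fix g assume "g \<in> act_group"
  then obtain w' where "g = act (ev h w')" by (auto simp: act_group_def)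
  then have "f \<circ> g = act (ev h (w @ w'))" using w act_comp by (simp add: ev_append)
  then show "f \<circ> g \<in> act_group" by (auto simp: act_group_def)
qed

lemma act_group_if_gens:
  assumes "perm_group J" "J \<subseteq> act_group" "\<And>i. act (h i) \<in> J"
  shows "J = act_group"
proof -
  interpret J: perm_group J by (rule assms)
  have "act (ev h w) \<in> J" for w
  proof (induction w)
    case Nil
    then show ?case using J.id_F by (simp only: ev_Nil act_id)
  next
    case (Cons i w)
    then show ?case
      using J.comp_F[OF assms(3)[of i] Cons.IH] act_comp[of "[i]" w]
      by (simp only: ev_Cons ev_Nil comp_id)
  qed
  then show ?thesis using assms(2) by (auto simp: act_group_def)
qed

lemma act_gen: "act (h i) \<in> act_group"
  unfolding act_group_def by (metis comp_id ev_Cons ev_Nil imageI rangeI)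

lemma tree_group_act: "tree_group act_group"
proof -
  interpret perm_group act_group by (rule perm_group_act)
  show ?thesis
  proof
    fix x y
    obtain w w' where w: "enum x = coset (ev h w)" "enum y = coset (ev h w')" by (metis enum_E)
    have "enum y = coset (ev h (w' @ rev w) \<circ> ev h w)" using w by (simp add: ev_append comp_assoc ev_rev)
    then have "act (ev h (w' @ rev w)) x = y" using act_eq_iff w by blast
    then show "\<exists>f\<in>act_group. f x = y" by (auto simp: act_group_def)
    have "{f \<in> act_group. f x = x} \<subseteq> act ` {id, ev h w \<circ> h 0 \<circ> ev h (rev w)}"
    proof
      fix f assume "f \<in> {f \<in> act_group. f x = x}"
      then obtain u where u: "f = act (ev h u)" "act (ev h u) x = x" by (auto simp: act_group_def)
      then have "coset (ev h u \<circ> ev h w) = coset (ev h w)" using act_eq_iff[OF w(1)] w(1) by simp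
      then have "ev h u \<circ> ev h w \<in> {ev h w, ev h w \<circ> h 0}" by (auto simp: coset_def)
      then have "ev h u \<circ> ev h w \<circ> ev h (rev w) \<in> {id, ev h w \<circ> h 0 \<circ> ev h (rev w)}"
        by (auto simp: ev_rev')
      then show "f \<in> act ` {id, ev h w \<circ> h 0 \<circ> ev h (rev w)}"
        using u(1) by (auto simp: comp_assoc ev_rev')
    qed
    then show "finite {f \<in> act_group. f x = x}" by (rule finite_subset) simp
    define u where "u = w @ [0] @ rev w"
    have uw: "ev h u \<circ> ev h w = ev h w \<circ> h 0" by (simp add: u_def ev_append comp_assoc ev_rev)
    have "coset (ev h u \<circ> ev h w) = coset (ev h w)"
      unfolding uw by (auto simp: coset_def comp_assoc invol)
    then have "act (ev h u) x = x" using act_eq_iff[OF w(1)] w(1) by simp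
    moreover have "act (ev h u) \<noteq> id"
    proof
      assume "act (ev h u) = id"
      then have "ev h w = ev h w \<circ> h 0" using act_faithful uw by fastforce
      then have "ev h (rev w) \<circ> ev h w = ev h (rev w) \<circ> ev h w \<circ> h 0" by (simp add: comp_assoc)
      then show False using gen0_neq_id by (simp add: ev_rev)
    qed
    ultimately show "\<exists>f\<in>act_group. f x = x \<and> f \<noteq> id" by (auto simp: act_group_def)
  next
    fix J assume J: "perm_group J" "J \<subseteq> act_group" "\<And>f x. f \<in> act_group \<Longrightarrow> f x = x \<Longrightarrow> f \<in> J"
    show "J = act_group"
    proof (rule act_group_if_gens[OF J(1,2)])
      fix i
      \<comment> \<open>By the braid relation \<open>h i\<close> is the conjugate of
        \<open>h 0\<close> by \<open>h 0 \<circ> h i\<close>, so it fixes the coset of the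
        latter.\<close>
      obtain n where n: "enum n = coset (ev h [0, i])" using ex_enum by blast
      have "coset (ev h [i] \<circ> ev h [0, i]) = coset (ev h [0, i])"
        using braid[of i] by (auto simp: coset_def comp_assoc invol)
      then have "act (ev h [i]) n = n" using act_eq_iff[OF n, of "[i]" n] n by blast
      then show "act (h i) \<in> J" using J(3)[OF act_gen] by simp
    qed
  next
    have "J = act_group" if "perm_group J" "J \<subseteq> act_group" "act ` range h \<subseteq> J" for J
      by (rule act_group_if_gens) (use that in auto)
    then show "\<exists>A. finite A \<and> A \<subseteq> act_group \<and>
        (\<forall>J. perm_group J \<longrightarrow> J \<subseteq> act_group \<longrightarrow> A \<subseteq> J \<longrightarrow> J = act_group)"
      using finite_gens act_gen by (intro exI[of _ "act ` range h"]) auto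
  qed
qed

end

text \<open>On three copies of the integers, exchanging the first two sheets along a permutation \<open>p\<close> is an
  involution satisfying the braid relation with the exchange of the last two sheets, and two such
  involutions multiply to \<open>p\<close> on the first sheet. This realises any finitely generated group of
  permutations of the integers inside a group generated by conjugate involutions.\<close>

definition sheet_swap :: "int \<times> nat \<Rightarrow> int \<times> nat" where
  "sheet_swap = (\<lambda>(y, n). (y, if n = 1 then 2 else if n = 2 then 1 else n))"

definition twist :: "(int \<Rightarrow> int) \<Rightarrow> (int \<Rightarrow> int) \<Rightarrow> int \<times> nat \<Rightarrow> int \<times> nat" where
  "twist p p' = (\<lambda>(y, n). if n = 0 then (p y, 1) else if n = 1 then (p' y, 0) else (y, n))"

definition swap01 :: "int \<Rightarrow> int" where
  "swap01 y = (if y = 0 then 1 else if y = 1 then 0 else y)"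

text \<open>The product of the transpositions of \<open>4 i + 1\<close> and \<open>4 i + 2\<close>
  over \<open>i\<close> in \<open>S\<close>: multiples of 4 stay fixed, and \<open>4 j + 1\<close>
  moves exactly when \<open>j\<close> is in \<open>S\<close>.\<close>

definition swaps :: "nat set \<Rightarrow> int \<Rightarrow> int" where
  "swaps S y = (if \<exists>i\<in>S. y = 4 * int i + 1 then y + 1
     else if \<exists>i\<in>S. y = 4 * int i + 2 then y - 1 else y)"

text \<open>Index 0 is the involution of the braid relation. Index 1 is the untwisted exchange;
  followed on the left by it, the generators 2, 3 and 4 act on sheet 0 as the unit shift,
  \<open>swap01\<close> and \<open>swaps S\<close>.\<close>

definition gens :: "nat set \<Rightarrow> nat \<Rightarrow> int \<times> nat \<Rightarrow> int \<times> nat" where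
  "gens S i = (if i = 1 then twist id id else if i = 2 then twist (\<lambda>y. y + 1) (\<lambda>y. y - 1)
     else if i = 3 then twist swap01 swap01 else if i = 4 then twist (swaps S) (swaps S)
     else sheet_swap)"

text \<open>The sign changes on sheet 1 because a twist acts there by the inverse
  permutation.\<close>

definition slide :: "int \<Rightarrow> int \<times> nat \<Rightarrow> int \<times> nat" where
  "slide k = (\<lambda>(y, n). if n = 0 then (y + k, 0) else if n = 1 then (y - k, 1) else (y, n))"

text \<open>Conjugating by the \<open>4 j\<close>-fold shift moves the transposition of \<open>4 j + 1\<close> and \<open>4 j + 2\<close> next to
  the transposition of \<open>0\<close> and \<open>1\<close>, so that commutation with the latter detects membership of \<open>j\<close>.\<close>

definition probe :: "nat \<Rightarrow> nat list" where
  "probe j = concat (replicate (4 * j) [2, 1]) @ [1, 4] @ concat (replicate (4 * j) [1, 2])"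

section \<open>Words in the concrete generators\<close>

lemma swap01_swap01 [simp]: "swap01 (swap01 y) = y"
  by (simp add: swap01_def)

lemma swaps_swaps [simp]: "swaps S (swaps S y) = y"
proof -
  have "4 * int i + 1 \<noteq> 4 * int j + 2" for i j by presburger
  then show ?thesis by (auto simp: swaps_def)
qed

lemma twist_twist: "(\<And>y. p' (p y) = y) \<Longrightarrow> (\<And>y. p (p' y) = y) \<Longrightarrow> twist p p' \<circ> twist p p' = id"
  by (auto simp: twist_def fun_eq_iff)

lemma twist_braid:
  "(\<And>y. p' (p y) = y) \<Longrightarrow> (\<And>y. p (p' y) = y) \<Longrightarrow>
     twist p p' \<circ> (sheet_swap \<circ> twist p p') = (sheet_swap \<circ> twist p p') \<circ> sheet_swap"
  by (auto simp: twist_def sheet_swap_def fun_eq_iff)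

lemma ev_slide: "ev (gens S) (concat (replicate n [1, 2])) = slide (int n)"
  by (induction n) (auto simp: gens_def twist_def slide_def fun_eq_iff)

lemma ev_slide': "ev (gens S) (concat (replicate n [2, 1])) = slide (- int n)"
  by (induction n) (auto simp: gens_def twist_def slide_def fun_eq_iff)

lemma ev_probe:
  "ev (gens S) (probe j) = (\<lambda>(y, n). if n = 0 then (swaps S (y + 4 * int j) - 4 * int j, 0)
     else if n = 1 then (swaps S (y - 4 * int j) + 4 * int j, 1) else (y, n))"
  unfolding probe_def ev_append ev_slide ev_slide'
  by (auto simp: gens_def twist_def slide_def fun_eq_iff)

interpretation gens: braid_gens "gens S" for S
proof
  fix i
  show "gens S i \<circ> gens S i = id"
    by (auto simp: gens_def twist_twist) (auto simp: sheet_swap_def fun_eq_iff)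
  show "gens S i \<circ> (gens S 0 \<circ> gens S i) = gens S 0 \<circ> gens S i \<circ> gens S 0"
    by (auto simp: gens_def twist_braid)
  have "(gens S 0 \<circ> gens S 1) (0, 0) \<noteq> (gens S 1 \<circ> gens S 0) (0, 0)"
    by (simp add: gens_def twist_def sheet_swap_def)
  then show "\<exists>i. gens S 0 \<circ> gens S i \<noteq> gens S i \<circ> gens S 0" by metis
  have "range (gens S) \<subseteq> gens S ` {0, 1, 2, 3, 4}"
  proof
    fix f assume "f \<in> range (gens S)"
    then obtain i where i: "f = gens S i" by blast
    show "f \<in> gens S ` {0, 1, 2, 3, 4}"
    proof (cases "i \<in> {0, 1, 2, 3, 4}")
      case False
      then have "f = gens S 0" using i by (simp add: gens_def)
      then show ?thesis by blast
    qed (use i in blast)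
  qed
  then show "finite (range (gens S))" by (rule finite_subset) simp
  have "inj (\<lambda>n. slide (int n))"
  proof (rule injI)
    fix m n assume "slide (int m) = slide (int n)"
    then have "slide (int m) (0, 0) = slide (int n) (0, 0)" by simp
    then show "m = n" by (simp add: slide_def)
  qed
  moreover have "range (\<lambda>n. slide (int n)) \<subseteq> range (ev (gens S))"
    using ev_slide by (metis image_subsetI rangeI)
  ultimately show "infinite (range (ev (gens S)))"
    using finite_subset range_inj_infinite by blast
qed

lemma swap01_commute:
  assumes "\<And>y. p (p y) = y" "p 0 = 0" "p 1 = 1"
  shows "swap01 (p y) = p (swap01 y)"
proof -
  have "p y = 0 \<longleftrightarrow> y = 0" "p y = 1 \<longleftrightarrow> y = 1" using assms by metis+
  then show ?thesis using assms by (auto simp: swap01_def)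
qed

lemma ev_probe_commute: "ev (gens S) (probe j @ [1, 3]) = ev (gens S) ([1, 3] @ probe j) \<longleftrightarrow> j \<notin> S"
proof -
  have u: "ev (gens S) [1, 3] =
      (\<lambda>(y, n). if n = 0 then (swap01 y, 0) else if n = 1 then (swap01 y, 1) else (y, n))"
    by (auto simp: gens_def twist_def fun_eq_iff)
  show ?thesis
  proof
    assume "ev (gens S) (probe j @ [1, 3]) = ev (gens S) ([1, 3] @ probe j)"
    \<comment> \<open>At 0 on sheet 0 one side applies \<open>swaps S\<close> at
      \<open>4 j + 1\<close>, the other at the fixed point \<open>4 j\<close>.\<close>
    then have "ev (gens S) (probe j @ [1, 3]) (0, 0) = ev (gens S) ([1, 3] @ probe j) (0, 0)" by simp
    then have eq: "swaps S (swap01 0 + 4 * int j) - 4 * int j = swap01 (swaps S (4 * int j) - 4 * int j)"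
      unfolding ev_append u ev_probe by simp
    have "swaps S (4 * int j) = 4 * int j" unfolding swaps_def by (auto; presburger)
    then have "swaps S (4 * int j + 1) = 4 * int j + 1" using eq by (simp add: swap01_def add.commute)
    then show "j \<notin> S" by (auto simp: swaps_def)
  next
    assume j: "j \<notin> S"
    have fix0: "swaps S (4 * int j) = 4 * int j" "swaps S (1 + 4 * int j) = 1 + 4 * int j"
      using j unfolding swaps_def by (auto; presburger)+
    \<comment> \<open>On sheet 1 the shift runs backwards, and commutation must hold there too. The
      position \<open>1 - 4 j\<close> can meet a transposition only for \<open>j = 0\<close>, where
      its index is again \<open>j\<close>.\<close>
    have "1 - 4 * int j = 4 * int i + 1 \<Longrightarrow> i = j" for i by presburger
    then have fix1: "swaps S (- (4 * int j)) = - (4 * int j)" "swaps S (1 - 4 * int j) = 1 - 4 * int j"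
      using j unfolding swaps_def by (auto; presburger)+
    have "swap01 (swaps S (y + 4 * int j) - 4 * int j) = swaps S (swap01 y + 4 * int j) - 4 * int j" for y
      by (rule swap01_commute[of "\<lambda>y. swaps S (y + 4 * int j) - 4 * int j"]) (simp_all add: fix0)
    moreover have "swap01 (swaps S (y - 4 * int j) + 4 * int j) = swaps S (swap01 y - 4 * int j) + 4 * int j" for y
      by (rule swap01_commute[of "\<lambda>y. swaps S (y - 4 * int j) + 4 * int j"]) (simp_all add: fix1)
    ultimately show "ev (gens S) (probe j @ [1, 3]) = ev (gens S) ([1, 3] @ probe j)"
      unfolding ev_append u ev_probe by (auto simp: fun_eq_iff)
  qed
qed

text \<open>The two words compared in \<open>ev_probe_commute\<close> are the same for every
  \<open>S\<close>, and since reversing a word inverts it, their equality is expressed by a single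
  relator.\<close>

lemma gens_relators_inject:
  assumes "\<And>w. ev (gens S) w = id \<longleftrightarrow> ev (gens S') w = id"
  shows "S = S'"
proof -
  have "j \<notin> S \<longleftrightarrow> j \<notin> S'" for j
    using ev_probe_commute[of S j] ev_probe_commute[of S' j] assms
    unfolding gens.ev_eq_iff by simp
  then show ?thesis by blast
qed

section \<open>Isomorphism classes are countable\<close>

instance vert :: countable
  by (rule countable_classI[of "\<lambda>v. to_nat (word v)"]) (simp add: word_inject)

context tree_group
begin

definition pick :: "vert list \<Rightarrow> vert list \<Rightarrow> vert \<Rightarrow> vert" where
  "pick bs l = (SOME q. q \<in> G \<and> map q bs = l)"

text \<open>The generators in \<open>gens\<close> are repetitive from index 5 on.\<close>

definition idx :: "nat \<Rightarrow> nat" where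
  "idx i = (if i < 5 then i else 0)"

text \<open>The parameter consists of finite lists over a countable type: test vertices
  \<open>bs\<close>, the restrictions \<open>ls\<close> to them of a compact open subgroup, and the
  restrictions \<open>hs\<close> of five generators. Its countability bounds the number of marked
  groups.\<close>

definition relators :: "vert list \<times> vert list list \<times> vert list list \<Rightarrow> nat list set" where
  "relators = (\<lambda>(bs, ls, hs). {w. map (ev (\<lambda>i. pick bs (hs ! idx i)) w) bs \<in> set ls})"

lemma pick:
  assumes "g \<in> G"
  shows "pick bs (map g bs) \<in> G" "map (pick bs (map g bs)) bs = map g bs"
  using someI[of "\<lambda>q. q \<in> G \<and> map q bs = map g bs" g] assms by (auto simp: pick_def)

lemma ev_G: "(\<And>i. k i \<in> G) \<Longrightarrow> ev k w \<in> G"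
proof (induction w)
  case Nil
  then show ?case by (simp only: ev_Nil id_G)
next
  case (Cons i w)
  then show ?case by (simp only: ev_Cons comp_G)
qed

lemma finite_restrictions:
  assumes "compactin T L"
  shows "finite ((\<lambda>g. map g bs) ` L)"
proof -
  have "continuous_map T (discrete_topology UNIV) (\<lambda>g. map g bs)"
    unfolding continuous_map_def
  proof (intro conjI allI impI)
    fix V
    show "openin T {g \<in> topspace T. map g bs \<in> V}"
      unfolding openin_T
    proof (intro conjI ballI)
      fix g assume g: "g \<in> {g \<in> topspace T. map g bs \<in> V}"
      have "h \<in> {g \<in> topspace T. map g bs \<in> V}" if "h \<in> G" "\<forall>b\<in>set bs. h b = g b" for h
      proof -
        have eq: "map h bs = map g bs" using that by simp
        have "map g bs \<in> V" using g by simp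
        then have "map h bs \<in> V" by (simp only: eq)
        then show ?thesis using that by simp
      qed
      then show "\<exists>B. finite B \<and> (\<forall>h\<in>G. (\<forall>b\<in>B. h b = g b) \<longrightarrow> h \<in> {g \<in> topspace T. map g bs \<in> V})"
        by (intro exI[of _ "set bs"]) simp
    qed auto
  qed simp
  from image_compactin[OF assms this] show ?thesis by (simp add: compactin_discrete_topology)
qed

text \<open>Since the \<open>k i\<close> normalise \<open>L\<close>, membership of words in \<open>L\<close> does not change when each \<open>k i\<close> is
  replaced by another representative of its coset; finitely many vertices pin down the cosets.\<close>

lemma ex_relators:
  assumes L: "openin T L" "compactin T L" "subgroup L Gm"
    and k: "\<And>i. k i \<in> G" "\<And>i. k (idx i) = k i"
    and norm: "\<And>i x. x \<in> L \<Longrightarrow> k i \<circ> x \<circ> inv (k i) \<in> L"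
  shows "\<exists>p. {w. ev k w \<in> L} = relators p"
proof -
  note LD = subgroup_GmD[OF L(3)]
  obtain B where B: "finite B" "\<And>h. h \<in> G \<Longrightarrow> (\<And>b. b \<in> B \<Longrightarrow> h b = id b) \<Longrightarrow> h \<in> L"
    using openin_TE[OF L(1) LD(2)] by blast
  obtain bs where bs: "set bs = B" using B(1) finite_list by blast
  obtain ls where ls: "set ls = (\<lambda>g. map g bs) ` L" using finite_restrictions[OF L(2)] finite_list by blast
  define hs where "hs = map (\<lambda>i. map (k i) bs) [0..<5]"
  define q where "q i = pick bs (hs ! idx i)" for i
  have q_pick: "q i = pick bs (map (k i) bs)" for i
  proof -
    have "idx i < 5" by (simp add: idx_def)
    then have "hs ! idx i = map (k (idx i)) bs" by (simp add: hs_def)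
    then show ?thesis by (simp add: q_def k(2))
  qed
  have qG: "q i \<in> G" and q_bs: "map (q i) bs = map (k i) bs" for i
    using pick[OF k(1)] q_pick by simp_all
  \<comment> \<open>\<open>L\<close> contains the fixator of \<open>bs\<close>, so it is a union of
    cosets of this fixator and is recognised by values on \<open>bs\<close>.\<close>
  have agree: "h \<in> L" if "g \<in> L" "h \<in> G" "map h bs = map g bs" for g h
  proof -
    have gG: "g \<in> G" using that LD by blast
    have "inv g \<circ> h \<in> L"
    proof (rule B(2))
      show "inv g \<circ> h \<in> G" using gG that(2) comp_G inv_G by blast
      fix b assume "b \<in> B"
      then have "h b = g b" using that(3) bs by auto
      then show "(inv g \<circ> h) b = id b" using gG by simp
    qed
    from LD(3)[OF that(1) this] have "g \<circ> (inv g \<circ> h) \<in> L" .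
    moreover have "g \<circ> (inv g \<circ> h) = h" using gG by (simp add: fun_eq_iff)
    ultimately show ?thesis by simp
  qed
  have qk: "q i \<circ> inv (k i) \<in> L" for i
  proof -
    have "inv (k i) \<circ> q i \<in> L"
    proof (rule agree[OF LD(2)])
      show "inv (k i) \<circ> q i \<in> G" using k(1) qG comp_G inv_G by blast
      have "q i b = k i b" if "b \<in> set bs" for b using q_bs[of i] that by simp
      then show "map (inv (k i) \<circ> q i) bs = map id bs"
        using k(1) by (auto intro!: map_idI)
    qed
    from norm[OF this, of i] have "k i \<circ> (inv (k i) \<circ> q i) \<circ> inv (k i) \<in> L" .
    moreover have "k i \<circ> (inv (k i) \<circ> q i) \<circ> inv (k i) = q i \<circ> inv (k i)"
      using k(1) by (simp add: fun_eq_iff)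
    ultimately show ?thesis by simp
  qed
  \<comment> \<open>Each \<open>q i\<close> differs from \<open>k i\<close> by an element of
    \<open>L\<close>; normality moves all these errors to the left end of the word.\<close>
  have ev_qk: "\<exists>x\<in>L. ev q w = x \<circ> ev k w" for w
  proof (induction w)
    case Nil
    show ?case using LD(2) by (intro bexI[of _ id]) simp_all
  next
    case (Cons i w)
    then obtain x where x: "x \<in> L" "ev q w = x \<circ> ev k w" by blast
    have "(q i \<circ> inv (k i)) \<circ> (k i \<circ> x \<circ> inv (k i)) \<in> L" using LD(3)[OF qk norm[OF x(1)]] .
    moreover have "ev q (i # w) = (q i \<circ> inv (k i)) \<circ> (k i \<circ> x \<circ> inv (k i)) \<circ> ev k (i # w)"
      using k(1) x(2) by (simp add: fun_eq_iff)
    ultimately show ?case by blast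
  qed
  have "ev k w \<in> L \<longleftrightarrow> map (ev q w) bs \<in> set ls" for w
  proof -
    obtain x where x: "x \<in> L" "ev q w = x \<circ> ev k w" using ev_qk by blast
    have xG: "x \<in> G" using x LD by blast
    have "ev k w \<in> L \<longleftrightarrow> ev q w \<in> L"
    proof
      assume "ev q w \<in> L"
      then have "inv x \<circ> (x \<circ> ev k w) \<in> L" using LD(3)[OF LD(4)[OF x(1)]] x(2) by simp
      moreover have "inv x \<circ> (x \<circ> ev k w) = ev k w" using xG by (simp add: fun_eq_iff)
      ultimately show "ev k w \<in> L" by simp
    qed (use LD(3) x in simp)
    also have "\<dots> \<longleftrightarrow> map (ev q w) bs \<in> set ls"
      using agree ev_G[of q w] qG unfolding ls by blast
    finally show ?thesis .
  qed
  then have "{w. ev k w \<in> L} = relators (bs, ls, hs)"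
    by (simp add: relators_def q_def[abs_def])
  then show ?thesis by blast
qed

section \<open>The fixator of the unit ball and lifts of local actions\<close>

lemma subgroup_ker: "subgroup ker Gm"
proof -
  have "id \<in> ker" by (simp add: ker_def id_G loc_id)
  then have "ker \<noteq> {}" by blast
  moreover have "ker \<subseteq> carrier Gm" by (auto simp: ker_def)
  moreover have "g \<circ> g' \<in> ker" if "g \<in> ker" "g' \<in> ker" for g g'
    using that comp_G by (simp add: ker_def loc_def)
  moreover have "m_inv Gm g \<in> ker" if "g \<in> ker" for g
  proof -
    have g: "g \<in> G" "g origin = origin" "loc g origin id" using that by (auto simp: ker_def)
    have "inv g origin = origin" using g inv_apply by metis
    moreover have "loc (inv g) origin id" using loc_inv_G[OF g(1,3)] g(2) by simp
    ultimately show ?thesis using g(1) by (simp add: ker_def inv_Gm inv_G)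
  qed
  ultimately show ?thesis
    by (intro group.subgroupI[OF group_Gm]) simp_all
qed

lemma ker_conj:
  assumes "g \<in> G" "g origin = origin" "x \<in> ker"
  shows "g \<circ> x \<circ> inv g \<in> ker"
proof -
  have x: "x \<in> G" "x origin = origin" "loc x origin id" using assms by (auto simp: ker_def)
  obtain f where f: "f \<in> F" "loc g origin f" using assms(1) by (rule G_E)
  have ir: "inv g origin = origin" using assms inv_apply by metis
  have "loc (inv g) origin (inv f)" using loc_inv_G[OF assms(1) f(2)] assms(2) by simp
  then have "loc (x \<circ> inv g) origin (inv f)" using loc_comp[of "inv g" origin "inv f" x id] x ir by simp
  then have "loc (g \<circ> (x \<circ> inv g)) origin (f \<circ> inv f)"
    using loc_comp[of "x \<circ> inv g" origin "inv f" g f] f ir x by simp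
  moreover have "f \<circ> inv f = id" using bij_F[OF f(1)] by (simp add: bij_is_surj surj_iff[symmetric])
  ultimately have "loc (g \<circ> x \<circ> inv g) origin id" by (simp add: comp_assoc)
  then show ?thesis using assms x ir by (simp add: ker_def comp_G inv_G)
qed

definition lift :: "(nat \<Rightarrow> nat) \<Rightarrow> vert \<Rightarrow> vert" where
  "lift f = (SOME g. g \<in> G \<and> g origin = origin \<and> loc g origin f)"

lemma lift: "f \<in> F \<Longrightarrow> lift f \<in> G \<and> lift f origin = origin \<and> loc (lift f) origin f"
  using someI_ex[of "\<lambda>g. g \<in> G \<and> g origin = origin \<and> loc g origin f"] ex_G_constant_local[of f origin origin]
  unfolding lift_def by blast

text \<open>\<open>lift\<close> merely chooses representatives, but local actions at the fixed
  vertex \<open>origin\<close> compose, so words in the lifts are correct modulo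
  \<open>ker\<close>.\<close>

lemma ev_lift:
  assumes "\<And>i. k i \<in> F"
  shows "ev (\<lambda>i. lift (k i)) w \<in> ker \<longleftrightarrow> ev k w = id"
proof -
  have *: "ev (\<lambda>i. lift (k i)) w origin = origin \<and> loc (ev (\<lambda>i. lift (k i)) w) origin (ev k w)"
  proof (induction w)
    case Nil
    show ?case by (simp add: loc_def)
  next
    case (Cons i w)
    then show ?case
      using lift[OF assms, of i] by (simp add: loc_def)
  qed
  have evG: "ev (\<lambda>i. lift (k i)) w \<in> G" by (rule ev_G) (use lift[OF assms] in blast)
  show ?thesis
  proof
    assume "ev (\<lambda>i. lift (k i)) w \<in> ker"
    then have "loc (ev (\<lambda>i. lift (k i)) w) origin id" by (simp add: ker_def)
    with * show "ev k w = id" by (blast intro: loc_unique)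
  next
    assume "ev k w = id"
    then have "loc (ev (\<lambda>i. lift (k i)) w) origin id" using * by (simp only:)
    then show "ev (\<lambda>i. lift (k i)) w \<in> ker" using * evG by (simp add: ker_def)
  qed
qed

end

interpretation GS: tree_group "gens.act_group S" for S
  by (rule gens.tree_group_act)

text \<open>The images of \<open>ker\<close> and of the lifted generators in the group for
  \<open>S0\<close> satisfy the hypotheses of \<open>ex_relators\<close>. Injectivity of the
  isomorphism, \<open>ev_lift\<close> and faithfulness of the coset action turn membership in
  \<open>L\<close> back into being a relator of \<open>gens S\<close>.\<close>

lemma iso_relators:
  assumes "topgroup_isomorphic (GS.Gm S) (GS.T S) (GS.Gm S0) (GS.T S0)"
  shows "\<exists>p. {w. ev (gens S) w = id} = GS.relators S0 p"
proof -
  obtain \<phi> where iso: "\<phi> \<in> iso (GS.Gm S) (GS.Gm S0)" and hom: "homeomorphic_map (GS.T S) (GS.T S0) \<phi>"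
    using assms by (auto simp: topgroup_isomorphic_def)
  interpret \<phi>: group_hom "GS.Gm S" "GS.Gm S0" \<phi>
    using iso GS.group_Gm by (simp add: group_hom_def group_hom_axioms_def iso_def)
  have inj: "inj_on \<phi> (GS.G S)" using iso by (simp add: iso_def bij_betw_def)
  have \<phi>_comp: "\<phi> (g \<circ> g') = \<phi> g \<circ> \<phi> g'" if "g \<in> GS.G S" "g' \<in> GS.G S" for g g'
    using \<phi>.hom_mult[of g g'] that by simp
  have \<phi>_id: "\<phi> id = id" using \<phi>.hom_one by simp
  have \<phi>_G: "\<phi> g \<in> GS.G S0" if "g \<in> GS.G S" for g using \<phi>.hom_closed[of g] that by simp
  have \<phi>_inv: "\<phi> (inv g) = inv (\<phi> g)" if "g \<in> GS.G S" for g
    using \<phi>.hom_inv[of g] that \<phi>_G by (simp add: GS.inv_Gm)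
  have kerG: "GS.ker S \<subseteq> GS.G S" by (auto simp: GS.ker_def)
  define l where "l i = GS.lift S (gens.act S (gens S i))" for i
  have l: "l i \<in> GS.G S" "l i origin = origin" for i
    using GS.lift[OF gens.act_gen] by (auto simp: l_def)
  define L where "L = \<phi> ` GS.ker S"
  define k where "k i = \<phi> (l i)" for i
  have "openin (GS.T S0) L"
    unfolding L_def using GS.openin_ker homeomorphic_imp_open_map[OF hom] by (simp add: open_map_def)
  moreover have "compactin (GS.T S0) L"
    unfolding L_def by (rule image_compactin[OF GS.compact_ker homeomorphic_imp_continuous_map[OF hom]])
  moreover have "subgroup L (GS.Gm S0)"
    unfolding L_def by (rule \<phi>.subgroup_img_is_subgroup[OF GS.subgroup_ker])
  moreover have "k i \<in> GS.G S0" for i unfolding k_def using \<phi>_G l by blast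
  moreover have "k (GS.idx i) = k i" for i
    by (simp add: k_def l_def GS.idx_def gens_def)
  moreover have "k i \<circ> y \<circ> inv (k i) \<in> L" if y: "y \<in> L" for i y
  proof -
    obtain x where x: "x \<in> GS.ker S" "y = \<phi> x" using y by (auto simp: L_def)
    have xG: "x \<in> GS.G S" using x kerG by blast
    have "\<phi> (l i \<circ> x \<circ> inv (l i)) = k i \<circ> y \<circ> inv (k i)"
      using l xG x(2) by (simp add: \<phi>_comp \<phi>_inv GS.comp_G GS.inv_G k_def)
    then show ?thesis using GS.ker_conj[OF l x(1)] unfolding L_def by (metis imageI)
  qed
  ultimately obtain p where p: "{w. ev k w \<in> L} = GS.relators S0 p"
    using GS.ex_relators[of S0 L k] by blast
  have ev_k: "ev k w = \<phi> (ev l w)" for w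
  proof (induction w)
    case Nil
    show ?case by (simp only: ev_Nil \<phi>_id)
  next
    case (Cons i w)
    then show ?case using l(1) GS.ev_G[of l S w] by (simp only: ev_Cons \<phi>_comp k_def)
  qed
  have "ev k w \<in> L \<longleftrightarrow> ev (gens S) w = id" for w
  proof -
    have "ev k w \<in> L \<longleftrightarrow> ev l w \<in> GS.ker S"
      unfolding L_def ev_k by (rule inj_on_image_mem_iff[OF inj GS.ev_G[OF l(1)] kerG])
    also have "\<dots> \<longleftrightarrow> ev (\<lambda>i. gens.act S (gens S i)) w = id"
      unfolding l_def[abs_def] by (rule GS.ev_lift[OF gens.act_gen])
    also have "ev (\<lambda>i. gens.act S (gens S i)) w = gens.act S (ev (gens S) w)"
    proof (rule ev_hom[symmetric])
      show "gens.act S id = id" by (rule gens.act_id)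
      show "gens.act S (gens S i \<circ> ev (gens S) w) = gens.act S (gens S i) \<circ> gens.act S (ev (gens S) w)" for w i
        using gens.act_comp[of S "[i]" w] by (simp only: ev_Cons ev_Nil comp_id)
    qed
    also have "\<dots> = id \<longleftrightarrow> ev (gens S) w = id"
      using gens.act_faithful gens.act_id by metis
    finally show ?thesis .
  qed
  then have "{w. ev (gens S) w = id} = {w. ev k w \<in> L}" by (simp only:)
  then show ?thesis using p by (intro exI[of _ p]) (simp only:)
qed

text \<open>The finite parameter determines the relators, which determine \<open>S\<close>.\<close>

lemma countable_iso_class:
  "countable {S. topgroup_isomorphic (GS.Gm S) (GS.T S) (GS.Gm S0) (GS.T S0)}" (is "countable ?I")
proof -
  define p where "p S = (SOME p. {w. ev (gens S) w = id} = GS.relators S0 p)" for S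
  have p: "{w. ev (gens S) w = id} = GS.relators S0 (p S)" if "S \<in> ?I" for S
    unfolding p_def by (rule someI_ex, rule iso_relators) (use that in simp)
  have "inj_on p ?I"
  proof (rule inj_onI)
    fix S S' assume "S \<in> ?I" "S' \<in> ?I" "p S = p S'"
    then have eq: "{w. ev (gens S) w = id} = {w. ev (gens S') w = id}" using p[of S] p[of S'] by (simp only:)
    have "w \<in> {w. ev (gens S) w = id} \<longleftrightarrow> w \<in> {w. ev (gens S') w = id}" for w by (simp only: eq)
    then show "S = S'" by (intro gens_relators_inject) (simp only: mem_Collect_eq)
  qed
  then show ?thesis by (rule countable_image_inj_on[rotated]) simp
qed

section \<open>Transport of structure to the reals\<close>

lemma topgroup_isomorphic_refl: "topgroup_isomorphic G T G T"
  unfolding topgroup_isomorphic_def by (intro exI[of _ id]) (simp add: iso_def hom_def)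

lemma topgroup_isomorphic_sym:
  assumes iso: "topgroup_isomorphic G T H U" and "group G" "topspace T = carrier G"
  shows "topgroup_isomorphic H U G T"
proof -
  obtain f where f: "f \<in> iso G H" "homeomorphic_map T U f"
    using iso by (auto simp: topgroup_isomorphic_def)
  obtain g where g: "homeomorphic_maps T U f g" using f(2) homeomorphic_map_maps by blast
  have "inv_into (carrier G) f \<in> iso H G" using group.iso_set_sym[OF assms(2) f(1)] .
  moreover have "inv_into (carrier G) f y = g y" if "y \<in> topspace U" for y
  proof (rule inv_into_f_eq)
    show "inj_on f (carrier G)" using f(1) by (simp add: iso_def bij_betw_def)
    show "g y \<in> carrier G" "f (g y) = y"
      using g that assms(3) by (auto simp: homeomorphic_maps_def continuous_map_def)
  qed
  then have "homeomorphic_map U T (inv_into (carrier G) f)"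
    using g homeomorphic_map_eq[of U T g "inv_into (carrier G) f"] by (simp add: homeomorphic_maps_map)
  ultimately show ?thesis by (auto simp: topgroup_isomorphic_def)
qed

lemma topgroup_isomorphic_trans:
  assumes "topgroup_isomorphic G T H U" "topgroup_isomorphic H U I V"
  shows "topgroup_isomorphic G T I V"
proof -
  obtain f g where "f \<in> iso G H" "homeomorphic_map T U f" "g \<in> iso H I" "homeomorphic_map U V g"
    using assms by (auto simp: topgroup_isomorphic_def)
  then have "g \<circ> f \<in> iso G I" "homeomorphic_map T V (g \<circ> f)"
    using iso_set_trans homeomorphic_map_compose by blast+
  then show ?thesis by (auto simp: topgroup_isomorphic_def)
qed

definition simple_cg_tdlc :: "('a, 'b) monoid_scheme \<Rightarrow> 'a topology \<Rightarrow> bool" where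
  "simple_cg_tdlc G T \<longleftrightarrow> topological_group G T \<and> totally_disconnected_space T \<and>
     locally_compact_space T \<and> compactly_generated_group G T \<and> abstractly_simple G \<and>
     T \<noteq> discrete_topology (carrier G)"

lemma simple_cg_tdlc_transport:
  assumes nice: "simple_cg_tdlc G T" and iso: "topgroup_isomorphic G T H U"
    and "group H" "topspace U = carrier H"
  shows "simple_cg_tdlc H U"
proof -
  have G: "topological_group G T" "totally_disconnected_space T" "locally_compact_space T"
    "compactly_generated_group G T" "abstractly_simple G" "T \<noteq> discrete_topology (carrier G)"
    using nice by (auto simp: simple_cg_tdlc_def)
  have grp: "group G" and topT: "topspace T = carrier G" using G(1) by (auto simp: topological_group_def)
  obtain f where f: "f \<in> iso G H" "homeomorphic_map T U f"
    using iso by (auto simp: topgroup_isomorphic_def)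
  obtain g where g: "homeomorphic_maps T U f g" using f(2) homeomorphic_map_maps by blast
  have gf: "\<And>x. x \<in> carrier G \<Longrightarrow> g (f x) = x" and fg: "\<And>y. y \<in> carrier H \<Longrightarrow> f (g y) = y"
    and f_closed: "\<And>x. x \<in> carrier G \<Longrightarrow> f x \<in> carrier H"
    and g_closed: "\<And>y. y \<in> carrier H \<Longrightarrow> g y \<in> carrier G"
    and cont: "continuous_map T U f" "continuous_map U T g"
    using g topT assms(4) by (auto simp: homeomorphic_maps_def continuous_map_def)
  interpret f: group_hom G H f
    using f(1) grp assms(3) by (simp add: group_hom_def group_hom_axioms_def iso_def)
  have surj: "f ` carrier G = carrier H" using f(1) by (simp add: iso_def bij_betw_def)
  have "topological_group H U"
    unfolding topological_group_def
  proof (intro conjI)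
    have "continuous_map (prod_topology U U) U (f \<circ> (\<lambda>(x, y). x \<otimes>\<^bsub>G\<^esub> y) \<circ> (\<lambda>z. (g (fst z), g (snd z))))"
    proof (intro continuous_map_compose)
      show "continuous_map (prod_topology U U) (prod_topology T T) (\<lambda>z. (g (fst z), g (snd z)))"
        using continuous_map_compose[OF continuous_map_fst[of U U] cont(2)]
          continuous_map_compose[OF continuous_map_snd[of U U] cont(2)]
        by (simp add: continuous_map_pairwise o_def)
      show "continuous_map (prod_topology T T) T (\<lambda>(x, y). x \<otimes>\<^bsub>G\<^esub> y)"
        using G(1) by (simp add: topological_group_def)
    qed (rule cont)
    then show "continuous_map (prod_topology U U) U (\<lambda>(x, y). x \<otimes>\<^bsub>H\<^esub> y)"
      by (rule continuous_map_eq) (auto simp: assms(4) g_closed fg)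
    have "continuous_map U U (f \<circ> (\<lambda>x. m_inv G x) \<circ> g)"
      using cont G(1) by (intro continuous_map_compose) (auto simp: topological_group_def)
    then show "continuous_map U U (\<lambda>x. m_inv H x)"
      by (rule continuous_map_eq) (auto simp: assms(4) g_closed fg)
  qed fact+
  moreover have "totally_disconnected_space U"
    unfolding totally_disconnected_space_def
  proof
    fix x assume x: "x \<in> topspace U"
    have "y = x" if xy: "connected_component_of U x y" for y
    proof -
      obtain S where S: "connectedin U S" "x \<in> S" "y \<in> S"
        using xy by (auto simp: connected_component_of_def)
      have "connectedin T (g ` S)" by (rule connectedin_continuous_map_image[OF cont(2) S(1)])
      then have "connected_component_of T (g x) (g y)"
        using S by (auto simp: connected_component_of_def)
      moreover have "g x \<in> topspace T" using x g_closed assms(4) topT by simp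
      ultimately have "g y = g x" using G(2) unfolding totally_disconnected_space_def by blast
      moreover have "y \<in> carrier H" using S connectedin_subset_topspace assms(4) by blast
      ultimately show ?thesis using fg x assms(4) by metis
    qed
    then show "connected_component_of_set U x = {x}"
      using x connected_component_of_refl by fastforce
  qed
  moreover have "locally_compact_space U"
    using G(3) homeomorphic_locally_compact_space homeomorphic_map_imp_homeomorphic_space[OF f(2)] by blast
  moreover have "compactly_generated_group H U"
  proof -
    obtain Q where Q: "compactin T Q" "Q \<subseteq> carrier G" "generate G Q = carrier G"
      using G(4) by (auto simp: compactly_generated_group_def)
    have "compactin U (f ` Q)" by (rule image_compactin[OF Q(1) cont(1)])
    moreover have "generate H (f ` Q) = carrier H" using f.generate_img[OF Q(2)] Q(3) surj by simp
    moreover have "f ` Q \<subseteq> carrier H" using Q(2) f_closed by blast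
    ultimately show ?thesis unfolding compactly_generated_group_def by blast
  qed
  moreover have "abstractly_simple H"
    unfolding abstractly_simple_def
  proof (intro conjI allI impI)
    show "carrier H \<noteq> {\<one>\<^bsub>H\<^esub>}"
    proof
      assume "carrier H = {\<one>\<^bsub>H\<^esub>}"
      then have "x = g \<one>\<^bsub>H\<^esub>" if "x \<in> carrier G" for x using gf f_closed that by (metis singletonD)
      then have "carrier G = {\<one>\<^bsub>G\<^esub>}" using f.G.one_closed by (metis equals0D is_singletonI' is_singleton_the_elem singletonD)
      then show False using G(5) by (simp add: abstractly_simple_def)
    qed
    fix N assume N: "N \<lhd> H"
    interpret N: normal N H by (rule N)
    define M where "M = {x \<in> carrier G. f x \<in> N}"
    have fM: "f ` M = N"
    proof
      show "N \<subseteq> f ` M"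
      proof
        fix y assume y: "y \<in> N"
        then have "y \<in> carrier H" using N.subset by blast
        then show "y \<in> f ` M" using y fg g_closed by (intro image_eqI[of _ _ "g y"]) (auto simp: M_def)
      qed
    qed (auto simp: M_def)
    have "subgroup M G"
      by (rule f.G.subgroupI) (auto simp: M_def intro!: exI[of _ "\<one>\<^bsub>G\<^esub>"])
    moreover have "\<forall>x\<in>carrier G. \<forall>h\<in>M. x \<otimes>\<^bsub>G\<^esub> h \<otimes>\<^bsub>G\<^esub> m_inv G x \<in> M"
      using N.inv_op_closed2 f_closed by (auto simp: M_def)
    ultimately have "M \<lhd> G" using f.G.normal_inv_iff by blast
    then have "M = {\<one>\<^bsub>G\<^esub>} \<or> M = carrier G" using G(5) by (simp add: abstractly_simple_def)
    then show "N = {\<one>\<^bsub>H\<^esub>} \<or> N = carrier H" using fM surj by auto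
  qed
  moreover have "U \<noteq> discrete_topology (carrier H)"
  proof
    assume U: "U = discrete_topology (carrier H)"
    have "openin T W \<longleftrightarrow> W \<subseteq> carrier G" for W
    proof
      assume W: "W \<subseteq> carrier G"
      then have "openin U (f ` W)" unfolding U using f_closed by auto
      then show "openin T W" using homeomorphic_map_openness[OF f(2)] W topT by simp
    qed (use openin_subset topT in blast)
    then have "T = discrete_topology (carrier G)" by (simp add: topology_eq)
    then show False using G(6) by simp
  qed
  ultimately show ?thesis by (simp add: simple_cg_tdlc_def)
qed

text \<open>The groups consist of maps on vertices, whereas real carriers are wanted; structure is
  carried along an injection, with \<open>inv e\<close> pulling the topology back.\<close>

lemma ex_copy_on:
  fixes e :: "'a \<Rightarrow> 'b" and G :: "'a monoid"
  assumes "inj e" "group G" "topspace T = carrier G"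
  shows "\<exists>(H :: 'b monoid) U. group H \<and> topspace U = carrier H \<and> topgroup_isomorphic G T H U"
proof -
  define H where "H = \<lparr>carrier = e ` carrier G, mult = (\<lambda>x y. e (inv e x \<otimes>\<^bsub>G\<^esub> inv e y)), one = e \<one>\<^bsub>G\<^esub>\<rparr>"
  define U where "U = pullback_topology (e ` carrier G) (inv e) T"
  have inv_e [simp]: "inv e (e x) = x" for x using assms(1) by (rule inv_f_f)
  have iso: "e \<in> iso G H"
    using inj_on_subset[OF assms(1), of "carrier G"] by (auto simp: iso_def hom_def H_def bij_betw_def)
  have "group (H\<lparr>one := e \<one>\<^bsub>G\<^esub>\<rparr>)" using group.iso_imp_img_group[OF assms(2) iso] .
  then have "group H" by (simp add: H_def)
  moreover have top: "topspace U = carrier H"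
    by (auto simp: U_def H_def topspace_pullback_topology assms(3))
  moreover have "homeomorphic_maps T U e (inv e)"
    unfolding homeomorphic_maps_def
  proof (intro conjI ballI)
    show "continuous_map T U e"
      unfolding U_def by (rule continuous_map_pullback') (auto simp: assms o_def)
    have "continuous_map U T (id \<circ> inv e)"
      unfolding U_def by (rule continuous_map_pullback) simp
    then show "continuous_map U T (inv e)" by simp
    show "e (inv e y) = y" if "y \<in> topspace U" for y using that top by (auto simp: H_def)
  qed simp
  ultimately show ?thesis
    using iso homeomorphic_maps_imp_map unfolding topgroup_isomorphic_def by blast
qed

text \<open>A map on the countable tree is coded by its graph, a set of natural numbers, and such
  sets embed into the reals.\<close>

lemma inj_vert_fun_real: "\<exists>e :: (vert \<Rightarrow> vert) \<Rightarrow> real. inj e"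
proof -
  obtain r :: "nat set \<Rightarrow> real" where r: "inj r" using nat_sets_lepoll_reals01 by (auto simp: lepoll_def)
  define c :: "(vert \<Rightarrow> vert) \<Rightarrow> nat set" where "c g = (\<lambda>v. to_nat (v, g v)) ` UNIV" for g
  have "inj c"
  proof (rule injI)
    fix g h assume gh: "c g = c h"
    have "g v = h v" for v
    proof -
      have "to_nat (v, g v) \<in> c h" unfolding gh[symmetric] by (simp add: c_def)
      then show ?thesis by (auto simp: c_def)
    qed
    then show "g = h" by blast
  qed
  then have "inj (r \<circ> c)" using r by (rule inj_compose[rotated])
  then show ?thesis by blast
qed

lemma uncountable_nat_sets: "uncountable (UNIV :: nat set set)"
proof
  assume "countable (UNIV :: nat set set)"
  then have "range (from_nat_into (UNIV :: nat set set)) = Pow UNIV"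
    using range_from_nat_into[of "UNIV :: nat set set"] by simp
  then show False using Cantors_theorem by blast
qed

lemma simple_cg_tdlc_GS: "simple_cg_tdlc (GS.Gm S) (GS.T S)"
  by (simp add: simple_cg_tdlc_def GS.topological_group_Gm GS.totally_disconnected_T
      GS.locally_compact_T GS.compactly_generated_Gm GS.simple_Gm GS.not_discrete_T
      del: GS.carrier_Gm)

theorem theorem7p4:
  shows "\<exists>S :: (real monoid \<times> real topology) set.
           uncountable S \<and>
           (\<forall>(G, T) \<in> S.
              topological_group G T \<and>
              totally_disconnected_space T \<and>
              locally_compact_space T \<and>
              compactly_generated_group G T \<and>
              abstractly_simple G \<and>
              T \<noteq> discrete_topology (carrier G)) \<and>
           (\<forall>(G, T) \<in> S. \<forall>(H, U) \<in> S.
              (G, T) \<noteq> (H, U) \<longrightarrow> \<not> topgroup_isomorphic G T H U)"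
proof -
  define R where "R S S' \<longleftrightarrow> topgroup_isomorphic (GS.Gm S) (GS.T S) (GS.Gm S') (GS.T S')" for S S'
  have R_refl: "R S S" for S by (simp add: R_def topgroup_isomorphic_refl)
  have R_sym: "R S S' \<Longrightarrow> R S' S" for S S'
    unfolding R_def by (rule topgroup_isomorphic_sym) (simp_all add: GS.group_Gm)
  have R_trans: "R S S' \<Longrightarrow> R S' S'' \<Longrightarrow> R S S''" for S S' S''
    unfolding R_def by (rule topgroup_isomorphic_trans)
  define rep where "rep S = (SOME S'. R S' S)" for S
  have rep: "R (rep S) S" for S unfolding rep_def using R_refl by (rule someI)
  have rep_eq: "rep S = rep S'" if "R (rep S) (rep S')" for S S'
  proof -
    have "R S S'" using that rep R_sym R_trans by blast
    \<comment> \<open>Equal predicates give equal \<open>SOME\<close> choices, so the representative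
      depends only on the class.\<close>
    then have "(\<lambda>x. R x S) = (\<lambda>x. R x S')" using R_sym R_trans by blast
    then show ?thesis by (simp add: rep_def)
  qed
  have unc: "uncountable (range rep)"
  proof
    assume "countable (range rep)"
    \<comment> \<open>Countably many classes, each countable, cannot exhaust all sets of natural
      numbers.\<close>
    then have "countable (\<Union>r\<in>range rep. {S. R S r})"
      by (rule countable_UN) (simp add: R_def countable_iso_class)
    moreover have "(\<Union>r\<in>range rep. {S. R S r}) = UNIV" using rep R_sym by blast
    ultimately show False using uncountable_nat_sets by simp
  qed
  obtain e :: "(vert \<Rightarrow> vert) \<Rightarrow> real" where "inj e" using inj_vert_fun_real by blast
  then have "\<exists>(H :: real monoid) U. group H \<and> topspace U = carrier H \<and>
      topgroup_isomorphic (GS.Gm S) (GS.T S) H U" for S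
    by (rule ex_copy_on) (simp_all add: GS.group_Gm)
  then obtain H :: "nat set \<Rightarrow> real monoid" and U where HU: "\<And>S. group (H S)"
    "\<And>S. topspace (U S) = carrier (H S)" "\<And>S. topgroup_isomorphic (GS.Gm S) (GS.T S) (H S) (U S)"
    by metis
  have R_if: "R S S'" if "topgroup_isomorphic (H S) (U S) (H S') (U S')" for S S'
  proof -
    have "topgroup_isomorphic (H S') (U S') (GS.Gm S') (GS.T S')"
      by (rule topgroup_isomorphic_sym[OF HU(3)]) (simp_all add: GS.group_Gm)
    then show ?thesis
      unfolding R_def
      by (rule topgroup_isomorphic_trans[OF topgroup_isomorphic_trans[OF HU(3) that]])
  qed
  let ?X = "(\<lambda>S. (H S, U S)) ` range rep"
  have "inj_on (\<lambda>S. (H S, U S)) (range rep)"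
  proof (rule inj_onI)
    fix S S' assume S: "S \<in> range rep" "S' \<in> range rep" "(H S, U S) = (H S', U S')"
    then have "R S S'" using R_if[of S S'] topgroup_isomorphic_refl[of "H S" "U S"] by simp
    then show "S = S'" using S rep_eq by blast
  qed
  then have "uncountable ?X" using unc countable_image_inj_on by blast
  moreover have "simple_cg_tdlc (H S) (U S)" for S
    by (rule simple_cg_tdlc_transport[OF simple_cg_tdlc_GS HU(3,1,2)])
  moreover have "(H S, U S) = (H S', U S')"
    if "S \<in> range rep" "S' \<in> range rep" "topgroup_isomorphic (H S) (U S) (H S') (U S')" for S S'
  proof -
    have "S = S'" using R_if[OF that(3)] that(1,2) rep_eq by blast
    then show ?thesis by simp
  qed
  ultimately show ?thesis
    unfolding simple_cg_tdlc_def by (intro exI[of _ ?X]) auto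
qed

end
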